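(* Let $\{Z_t\}_{t\ge 0}$ be a theta-positive branching process in varying environment with parameters $(\theta,\{\lambda_t\},\{a_t\})$, where $\theta\in(0,1]$. The process is strictly subcritical if and only if $V_\theta=\infty$ and $$\mu_t^{\theta}V_{t,\theta}\to M_\theta\quad\text{as }t\to\infty,\qquad\text{for some } 0\le M_\theta<\infty.$$ In this case, as $t\to\infty$, $\mu_t\to0$, $$\mathrm{P}(Z_t>0)\sim m^{-1}\mu_t,\qquad m_t\to m,\qquad\text{where } m=\big(M_\theta+\theta(1+\theta)^{-1}\big)^{1/\theta},$$ and $$\mathrm{E}(s^{Z_t}\mid Z_t>0)\to1-m\big(M_\theta-(1+\theta)^{-1}+(1-s)^{-\theta}\big)^{-1/\theta},\qquad 0\le s\le1$$ (the right-hand side being read as $1$ for $s=1$).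
   Context: Theta-positive branching process in varying environment with parameters $(\theta,\{\lambda_t\},\{a_t\})$: fix $\theta\in(0,1]$ and measurable functions $t\mapsto\lambda_t\ge0$ and $t\mapsto a_t$ on $[0,\infty)$ such that $\Lambda_t=\int_0^t\lambda_u\,du<\infty$ for all $t\ge0$ and $0\le a_t\le 1+1/\theta$ for all $t\ge 0$. The process $\{Z_t\}_{t\ge0}$ is the time-inhomogeneous continuous-time Markov branching process on $\{0,1,2,\dots\}$ with $Z_0=1$ (right-continuous sample paths) in which individuals live and reproduce independently; an individual alive at time $t$ dies during $(t,t+\delta)$ with probability $\lambda_t\delta+o(\delta)$ as $\delta\to0$, and an individual dying at time $t$ is instantaneously replaced by $k$ offspring with probability $p_t(k)$, where $k=0$ or $k\ge2$. (So from state $n$ the process jumps to $n-1+k$ at rate $n\lambda_tp_t(k)$ at time $t$.) The offspring probability generating function is $h_t(s)=p_t(0)+\sum_{k\ge2}p_t(k)s^k=1-a_t(1-s)+a_t(1+\theta)^{-1}(1-s)^{1+\theta}$, $0\le s\le 1$; in particular $a_t=\sum_{k\ge 2} kp_t(k)$ is the mean offspring number. Notation: $\mu_t=\mathrm{E}(Z_t)=\exp\{\int_0^t(a_u-1)\,d\Lambda_u\}$, where $d\Lambda_u=\lambda_u\,du$; $m_t=\mathrm{E}(Z_t\mid Z_t>0)$; $q=\lim_{t\to\infty}\mathrm{P}(Z_t=0)$ is the extinction probability; $V_{t,\theta}=\theta(1+\theta)^{-1}\int_0^t\mu_u^{-\theta}\,d\Lambda_u$; $V_\theta=\lim_{t\to\infty}V_{t,\theta}\in[0,\infty]$.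 Here $f(t)\sim g(t)$ means $f(t)/g(t)\to1$. The process is called strictly subcritical if $q=1$ and $\lim_{t\to\infty}m_t$ exists and belongs to $[1,\infty)$. *)

theory Defs
  imports "HOL-Probability.Probability"
begin

locale theta_environment =
  fixes \<theta> :: real and lam a :: "real \<Rightarrow> real" and p :: "real \<Rightarrow> nat pmf"
  assumes theta_range: "0 < \<theta>" "\<theta> \<le> 1"
    and lam_measurable: "lam \<in> borel_measurable (restrict_space borel {0..})"
    and lam_nonneg: "\<And>t. 0 \<le> t \<Longrightarrow> 0 \<le> lam t"
    and lam_integrable: "\<And>t. 0 \<le> t \<Longrightarrow> set_integrable lborel {0..t} lam"
    and a_measurable: "a \<in> borel_measurable (restrict_space borel {0..})"
    and a_range: "\<And>t. 0 \<le> t \<Longrightarrow> 0 \<le> a t \<and> a t \<le> 1 + 1 / \<theta>"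
    and offspring_not_one: "\<And>t. 0 \<le> t \<Longrightarrow> pmf (p t) 1 = 0"
    and offspring_pgf: "\<And>t s. 0 \<le> t \<Longrightarrow> 0 \<le> s \<Longrightarrow> s \<le> 1 \<Longrightarrow>
      (\<Sum>k. pmf (p t) k * s ^ k) = 1 - a t * (1 - s) + a t / (1 + \<theta>) * (1 - s) powr (1 + \<theta>)"

definition past_events :: "'w measure \<Rightarrow> (real \<Rightarrow> 'w \<Rightarrow> nat) \<Rightarrow> real \<Rightarrow> 'w set set" where
  "past_events M Z s =
     sigma_sets (space M) {{\<omega> \<in> space M. Z u \<omega> = n} | u n. 0 \<le> u \<and> u \<le> s}"

definition iid_sum_pmf :: "nat \<Rightarrow> nat pmf \<Rightarrow> nat pmf" where
  "iid_sum_pmf n K = map_pmf sum_list (replicate_pmf n K)"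

text \<open>
  The Markov property together with independent, identical reproduction of the individuals: given
  the past up to time \<open>s\<close> and \<open>Z s = n\<close>, the population at time \<open>t\<close> is a sum of \<open>n\<close> independent
  family sizes with a common law \<open>K s t\<close>. As the case \<open>n = 1\<close> shows, \<open>K s t\<close> is the
  conditional law of \<open>Z t\<close> given \<open>Z s = 1\<close>. Conditional probabilities are written in product form,
  so that conditioning events of probability zero impose nothing.
\<close>
definition markov_branching :: "'w measure \<Rightarrow> (real \<Rightarrow> 'w \<Rightarrow> nat) \<Rightarrow> bool" where
  "markov_branching M Z \<longleftrightarrow>
     (\<exists>K :: real \<Rightarrow> real \<Rightarrow> nat pmf. \<forall>s t n j. \<forall>A \<in> past_events M Z s. 0 \<le> s \<longrightarrow> s \<le> t \<longrightarrow>
        measure M (A \<inter> {\<omega> \<in> space M. Z s \<omega> = n \<and> Z t \<omega> = j}) =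
        measure M (A \<inter> {\<omega> \<in> space M. Z s \<omega> = n}) * pmf (iid_sum_pmf n (K s t)) j)"

text \<open>
  Since \<open>lam\<close> is only measurable, the infinitesimal rule ``an individual alive at time \<open>t\<close> dies
  during \<open>(t, t + \<delta>)\<close> with probability \<open>lam t * \<delta> + o(\<delta>)\<close> and is then replaced by \<open>k\<close> offspring with
  probability \<open>pmf (p t) k\<close>'' is read as: the lifetime has hazard rate \<open>lam\<close>, and given death at
  time \<open>u\<close> the offspring number has law \<open>p u\<close>. It is stated for a population of size one; the
  rates \<open>n * lam t * pmf (p t) k\<close> of the jumps from \<open>n\<close> to \<open>n - 1 + k\<close> follow by
  \<open>markov_branching\<close>. The event in \<open>offspring\<close> says that the first death after time \<open>s\<close> occurs
  at some \<open>u \<le> t\<close> and leaves \<open>k\<close> individuals.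
\<close>
locale theta_positive_bpve = prob_space M + theta_environment \<theta> lam a p
  for M :: "'w measure" and Z :: "real \<Rightarrow> 'w \<Rightarrow> nat"
    and \<theta> :: real and lam a :: "real \<Rightarrow> real" and p :: "real \<Rightarrow> nat pmf" +
  assumes Z_measurable: "\<And>t. 0 \<le> t \<Longrightarrow> Z t \<in> measurable M (count_space UNIV)"
    and Z_initial: "\<And>\<omega>. \<omega> \<in> space M \<Longrightarrow> Z 0 \<omega> = 1"
    and Z_right_continuous:
      "\<And>\<omega> t. \<omega> \<in> space M \<Longrightarrow> 0 \<le> t \<Longrightarrow> continuous (at_right t) (\<lambda>u. Z u \<omega>)"
    and branching: "markov_branching M Z"
    and lifetime: "\<And>s t. 0 \<le> s \<Longrightarrow> s \<le> t \<Longrightarrow>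
      measure M {\<omega> \<in> space M. \<forall>u\<in>{s..t}. Z u \<omega> = 1} =
      measure M {\<omega> \<in> space M. Z s \<omega> = 1} * exp (- (LINT v:{s..t}|lborel. lam v))"
    and offspring: "\<And>s t k. 0 \<le> s \<Longrightarrow> s \<le> t \<Longrightarrow> k \<noteq> 1 \<Longrightarrow>
      measure M {\<omega> \<in> space M. \<exists>u\<in>{s<..t}. (\<forall>v\<in>{s..<u}. Z v \<omega> = 1) \<and> Z u \<omega> = k} =
      measure M {\<omega> \<in> space M. Z s \<omega> = 1} *
      (LINT u:{s..t}|lborel. exp (- (LINT v:{s..u}|lborel. lam v)) * lam u * pmf (p u) k)"

definition mean_size :: "'w measure \<Rightarrow> (real \<Rightarrow> 'w \<Rightarrow> nat) \<Rightarrow> real \<Rightarrow> real" where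
  "mean_size M Z t = (LINT \<omega>|M. real (Z t \<omega>))"

definition survival_prob :: "'w measure \<Rightarrow> (real \<Rightarrow> 'w \<Rightarrow> nat) \<Rightarrow> real \<Rightarrow> real" where
  "survival_prob M Z t = measure M {\<omega> \<in> space M. Z t \<omega> > 0}"

definition cond_exp_survival ::
    "'w measure \<Rightarrow> (real \<Rightarrow> 'w \<Rightarrow> nat) \<Rightarrow> real \<Rightarrow> (nat \<Rightarrow> real) \<Rightarrow> real" where
  "cond_exp_survival M Z t f =
     (LINT \<omega>:{\<omega> \<in> space M. Z t \<omega> > 0}|M. f (Z t \<omega>)) / survival_prob M Z t"

definition cond_mean_size :: "'w measure \<Rightarrow> (real \<Rightarrow> 'w \<Rightarrow> nat) \<Rightarrow> real \<Rightarrow> real" where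
  "cond_mean_size M Z t = cond_exp_survival M Z t real"

definition V_theta ::
    "'w measure \<Rightarrow> (real \<Rightarrow> 'w \<Rightarrow> nat) \<Rightarrow> real \<Rightarrow> (real \<Rightarrow> real) \<Rightarrow> real \<Rightarrow> real" where
  "V_theta M Z \<theta> lam t =
     \<theta> / (1 + \<theta>) * (LINT u:{0..t}|lborel. mean_size M Z u powr (- \<theta>) * lam u)"

text \<open>The first conjunct says that the extinction probability equals \<open>1\<close>.\<close>
definition strictly_subcritical :: "'w measure \<Rightarrow> (real \<Rightarrow> 'w \<Rightarrow> nat) \<Rightarrow> bool" where
  "strictly_subcritical M Z \<longleftrightarrow>
     ((\<lambda>t. measure M {\<omega> \<in> space M. Z t \<omega> = 0}) \<longlongrightarrow> 1) at_top \<and>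
     (\<exists>m\<ge>1. (cond_mean_size M Z \<longlongrightarrow> m) at_top)"

end

theory Submission
  imports Defs
begin

text \<open>
  The generating function of \<open>Z t\<close> is explicit, and the theorem is read off from it. Fix \<open>t\<close> and \<open>x\<close> and
  let \<open>w s = 1 - E (x ^ Z t | Z s = 1)\<close>. Formally, the backward equation is the Bernoulli equation
  \<open>dw / d\<Lambda> = (1 - a) w + a w\<^bsup>1 + \<theta>\<^esup> / (1 + \<theta>)\<close>, which is linear in \<open>w\<^bsup>-\<theta>\<^esup>\<close>; it has the first integral
  \<open>\<mu>\<^sub>s\<^bsup>-\<theta>\<^esup> (w\<^bsup>-\<theta>\<^esup> - 1 / (1 + \<theta>)) + V\<^sub>s\<close>. Comparing \<open>s = 0\<close> with \<open>s = t\<close>, where \<open>w = 1 - x\<close>, yields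
  \<open>explicit_pgf_formula\<close>.

  The death rate is only measurable, and the process is given through its Markov property, the
  lifetimes and the first deaths, so the equation is not derived as a differential equation. It is
  shown instead that the first integral changes over \<open>{s..r}\<close> by at most a multiple of
  \<open>(\<Lambda>\<^sub>r - \<Lambda>\<^sub>s)\<^sup>2\<close>, which forces it to be constant (\<open>constant_if_quadratic_increments\<close>). The input is a
  second-order expansion of the transition kernel, \<open>kernel_expansion\<close>. Lower bounds for the
  transition probabilities are enough for it: they come from the paths with at most one death
  (\<open>kernel_one_ge\<close>, \<open>kernel_ge\<close>), their sum falls short of \<open>1\<close> only by a term of second order, and
  so they are exact up to such a term. The algebra behind the first integral is \<open>bernoulli_step\<close>.

  For the asymptotics, \<open>survival_formula\<close> writes \<open>1 - E (x ^ Z t)\<close> as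
  \<open>\<mu>\<^sub>t ((1 - x)\<^bsup>-\<theta>\<^esup> - 1 / (1 + \<theta>) + \<mu>\<^sub>t\<^sup>\<theta> V\<^sub>t + \<mu>\<^sub>t\<^sup>\<theta> / (1 + \<theta>))\<^bsup>-1/\<theta>\<^esup>\<close>. In particular the conditional mean
  satisfies \<open>m\<^sub>t\<^sup>\<theta> = \<theta> / (1 + \<theta>) + \<mu>\<^sub>t\<^sup>\<theta> V\<^sub>t + \<mu>\<^sub>t\<^sup>\<theta> / (1 + \<theta>)\<close>. When \<open>\<mu>\<^sub>t\<close> vanishes, convergence of \<open>m\<^sub>t\<close> and of
  \<open>\<mu>\<^sub>t\<^sup>\<theta> V\<^sub>t\<close> are therefore the same thing, and all the limits follow by continuity. If the process
  is strictly subcritical, \<open>\<mu>\<^sub>t\<close> vanishes because it is \<open>m\<^sub>t\<close> times the survival probability, and the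
  trivial bound \<open>m\<^sub>t \<ge> 1\<close> reads \<open>\<mu>\<^sub>t\<^bsup>-\<theta>\<^esup> \<le> 1 + (1 + \<theta>) V\<^sub>t\<close>, so that \<open>V\<^sub>t\<close> diverges. Conversely, if
  \<open>V\<^sub>t\<close> diverges and \<open>\<mu>\<^sub>t\<^sup>\<theta> V\<^sub>t\<close> converges, then \<open>\<mu>\<^sub>t\<close> vanishes.
\<close>

section \<open>Generating functions of branching kernels\<close>

definition pgf :: "nat pmf \<Rightarrow> real \<Rightarrow> real" where
  "pgf q x = measure_pmf.expectation q (\<lambda>k. x ^ k)"

lemma integrable_power_pmf:
  fixes q :: "nat pmf" and x :: real
  assumes "0 \<le> x" "x \<le> 1"
  shows "integrable (measure_pmf q) (\<lambda>k. x ^ k)"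
  using assms
  by (intro measure_pmf.integrable_const_bound[where B=1]) (auto simp: power_le_one)

lemma expectation_pmf_sums:
  fixes f :: "nat \<Rightarrow> real"
  assumes "integrable (measure_pmf q) f"
  shows "(\<lambda>k. pmf q k * f k) sums measure_pmf.expectation q f"
proof -
  have int: "integrable (count_space UNIV) (\<lambda>k. pmf q k * f k)"
    using assms unfolding measure_pmf_eq_density by (subst (asm) integrable_density) auto
  have "measure_pmf.expectation q f = (\<integral>k. pmf q k * f k \<partial>count_space UNIV)"
    unfolding measure_pmf_eq_density by (subst integral_density) auto
  with sums_integral_count_space_nat[OF int] show ?thesis by simp
qed

lemma pgf_sums:
  assumes "0 \<le> x" "x \<le> 1"
  shows "(\<lambda>k. pmf q k * x ^ k) sums pgf q x"
  unfolding pgf_def by (intro expectation_pmf_sums integrable_power_pmf assms)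

lemma ennreal_pgf:
  assumes "0 \<le> x" "x \<le> 1"
  shows "ennreal (pgf q x) = (\<integral>\<^sup>+k. ennreal (x ^ k) \<partial>measure_pmf q)"
  unfolding pgf_def using assms
  by (intro nn_integral_eq_integral[symmetric] integrable_power_pmf) auto

lemma pgf_nonneg: "0 \<le> x \<Longrightarrow> 0 \<le> pgf q x"
  unfolding pgf_def by (intro integral_nonneg_AE) auto

lemma pgf_one [simp]: "pgf q 1 = 1"
  unfolding pgf_def power_one by simp

lemma pgf_mono: "0 \<le> x \<Longrightarrow> x \<le> y \<Longrightarrow> y \<le> 1 \<Longrightarrow> pgf q x \<le> pgf q y"
  unfolding pgf_def by (intro integral_mono integrable_power_pmf power_mono) auto

lemma pgf_le_one: "0 \<le> x \<Longrightarrow> x \<le> 1 \<Longrightarrow> pgf q x \<le> 1"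
  using pgf_mono[of x 1 q] by simp

lemma pgf_iid_sum:
  assumes "0 \<le> x" "x \<le> 1"
  shows "pgf (iid_sum_pmf n K) x = pgf K x ^ n"
proof (induction n)
  case 0
  then show ?case by (simp add: iid_sum_pmf_def pgf_def)
next
  case (Suc n)
  have "ennreal (pgf (iid_sum_pmf (Suc n) K) x) =
      (\<integral>\<^sup>+k. \<integral>\<^sup>+xs. ennreal (x ^ k) * ennreal (x ^ sum_list xs) \<partial>replicate_pmf n K \<partial>K)"
    using assms by (simp add: ennreal_pgf iid_sum_pmf_def power_add ennreal_mult)
  also have "\<dots> = ennreal (pgf K x) * ennreal (pgf (iid_sum_pmf n K) x)"
    using assms by (simp add: ennreal_pgf iid_sum_pmf_def nn_integral_cmult nn_integral_multc)
  also have "\<dots> = ennreal (pgf K x * pgf K x ^ n)"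
    using assms Suc by (simp add: ennreal_mult pgf_nonneg)
  finally show ?case
    using assms by (simp add: pgf_nonneg)
qed

text \<open>
  Branching turns composition of kernels into composition of generating functions: conditionally on
  \<open>n\<close> ancestors the generating function of the sum of their families is \<open>pgf K x ^ n\<close>.
\<close>

lemma pgf_bind_iid_sum:
  assumes "0 \<le> x" "x \<le> 1"
  shows "pgf (bind_pmf q (\<lambda>n. iid_sum_pmf n K)) x = pgf q (pgf K x)"
proof -
  have K: "0 \<le> pgf K x" "pgf K x \<le> 1"
    using assms by (auto intro: pgf_nonneg pgf_le_one)
  have "ennreal (pgf (bind_pmf q (\<lambda>n. iid_sum_pmf n K)) x) =
      (\<integral>\<^sup>+n. ennreal (pgf (iid_sum_pmf n K) x) \<partial>q)"
    using assms by (simp add: ennreal_pgf)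
  also have "\<dots> = ennreal (pgf q (pgf K x))"
    using assms K by (simp add: pgf_iid_sum ennreal_pgf)
  finally show ?thesis using assms K by (simp add: pgf_nonneg)
qed

lemma iid_sum_pmf_1 [simp]: "iid_sum_pmf (Suc 0) K = K"
  by (simp add: iid_sum_pmf_def map_pmf_def bind_return_pmf bind_assoc_pmf bind_return_pmf')

lemma pmf_bind_ge: "pmf q x * pmf (f x) y \<le> pmf (bind_pmf q f) y"
proof -
  have "ennreal (pmf q x * pmf (f x) y) = (\<integral>\<^sup>+z. ennreal (pmf (f x) y) * indicator {x} z \<partial>q)"
    by (simp add: emeasure_pmf_single ennreal_mult mult.commute)
  also have "\<dots> \<le> (\<integral>\<^sup>+z. ennreal (pmf (f z) y) \<partial>q)"
    by (intro nn_integral_mono) (auto split: split_indicator)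
  finally show ?thesis by (simp add: ennreal_pmf_bind[symmetric])
qed

text \<open>
  A population of size \<open>n\<close> certainly keeps its size if every family has exactly one member.
\<close>

lemma pmf_iid_sum_unchanged:
  "pmf K 1 ^ n \<le> pmf (iid_sum_pmf n K) n"
proof (induction n)
  case 0
  then show ?case by (simp add: iid_sum_pmf_def)
next
  case (Suc n)
  have eq: "iid_sum_pmf (Suc n) K = K \<bind> (\<lambda>x. iid_sum_pmf n K \<bind> (\<lambda>y. return_pmf (x + y)))"
    by (simp add: iid_sum_pmf_def map_pmf_def bind_return_pmf bind_assoc_pmf)
  have "pmf K 1 ^ Suc n \<le> pmf K 1 * pmf (iid_sum_pmf n K) n"
    using Suc by (simp add: mult_left_mono)
  also have "\<dots> \<le> pmf K 1 * pmf (iid_sum_pmf n K \<bind> (\<lambda>y. return_pmf (1 + y))) (Suc n)"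
    using pmf_bind_ge[of "iid_sum_pmf n K" n "\<lambda>y. return_pmf (1 + y)" "Suc n"]
    by (intro mult_left_mono) auto
  also have "\<dots> \<le> pmf (iid_sum_pmf (Suc n) K) (Suc n)"
    unfolding eq by (rule pmf_bind_ge)
  finally show ?case .
qed

section \<open>Power series and quadratic increments\<close>

text \<open>
  The offspring generating function is known for real arguments in the unit interval only, so the
  coefficients are compared by letting the argument tend to \<open>0\<close> from the right.
\<close>

lemma power_series_unique:
  fixes c d :: "nat \<Rightarrow> real"
  assumes c: "\<And>s. 0 < s \<Longrightarrow> s < 1 \<Longrightarrow> (\<lambda>k. c k * s ^ k) sums f s"
    and d: "\<And>s. 0 < s \<Longrightarrow> s < 1 \<Longrightarrow> (\<lambda>k. d k * s ^ k) sums f s"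
  shows "c n = d n"
proof (rule ccontr)
  assume "c n \<noteq> d n"
  define e where "e k = c k - d k" for k
  define m where "m = (LEAST k. e k \<noteq> 0)"
  have m: "e m \<noteq> 0"
    unfolding m_def by (rule LeastI[of _ n]) (use \<open>c n \<noteq> d n\<close> in \<open>simp add: e_def\<close>)
  have less: "e k = 0" if "k < m" for k
    using not_less_Least[of k "\<lambda>k. e k \<noteq> 0"] that unfolding m_def by blast
  have sums0: "(\<lambda>k. e (k + m) * s ^ k) sums 0" if "0 < s" "s < 1" for s
  proof -
    have "(\<lambda>k. e k * s ^ k) sums 0"
      using sums_diff[OF c[OF that] d[OF that]] by (simp add: e_def algebra_simps)
    hence "(\<lambda>k. e (k + m) * s ^ (k + m)) sums 0"
      by (subst sums_iff_shift) (simp add: less)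
    hence "(\<lambda>k. (e (k + m) * s ^ (k + m)) / s ^ m) sums (0 / s ^ m)"
      by (rule sums_divide)
    with that show ?thesis by (simp add: power_add)
  qed
  have "summable (\<lambda>k. e (k + m) * (1/2) ^ k)"
    using sums0[of "1/2"] by (simp add: sums_iff)
  hence "isCont (\<lambda>s. \<Sum>k. e (k + m) * s ^ k) 0"
    by (rule isCont_powser) simp
  hence "((\<lambda>s. \<Sum>k. e (k + m) * s ^ k) \<longlongrightarrow> (\<Sum>k. e (k + m) * 0 ^ k)) (at_right 0)"
    unfolding isCont_def by (rule filterlim_mono) (auto simp: at_le)
  hence "((\<lambda>s. \<Sum>k. e (k + m) * s ^ k) \<longlongrightarrow> e m) (at_right 0)"
    using powser_zero[of "\<lambda>k. e (k + m)"] by simp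
  moreover have "((\<lambda>s. \<Sum>k. e (k + m) * s ^ k) \<longlongrightarrow> 0) (at_right 0)"
  proof (rule tendsto_eventually)
    have "eventually (\<lambda>s. s \<in> {0<..<1}) (at_right (0::real))"
      by (rule eventually_at_right_real) simp
    thus "eventually (\<lambda>s. (\<Sum>k. e (k + m) * s ^ k) = 0) (at_right 0)"
      by eventually_elim (use sums0 in \<open>auto simp: sums_iff\<close>)
  qed
  ultimately have "e m = 0"
    by (rule tendsto_unique[rotated]) simp
  with m show False by simp
qed

text \<open>
  This replaces the fundamental theorem of calculus when the clock \<open>G\<close> is merely continuous. By the
  intermediate value theorem an interval can be cut where \<open>G\<close> has run through half of its increment;
  each of the two pieces then contributes a quarter of the squared increment, so that every bisection
  halves the bound.
\<close>

lemma constant_if_quadratic_increments: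
  fixes g G :: "real \<Rightarrow> real"
  assumes cont: "continuous_on {u..v} G" and "u \<le> v"
    and incr: "\<And>r s. u \<le> r \<Longrightarrow> r \<le> s \<Longrightarrow> s \<le> v \<Longrightarrow> \<bar>g s - g r\<bar> \<le> C * (G s - G r)\<^sup>2"
  shows "g v = g u"
proof -
  have bound: "\<bar>g s - g r\<bar> \<le> C * (G s - G r)\<^sup>2 / 2 ^ n"
    if "u \<le> r" "r \<le> s" "s \<le> v" for r s n
    using that
  proof (induction n arbitrary: r s)
    case 0
    then show ?case using incr by simp
  next
    case (Suc n)
    have cont': "continuous_on {r..s} G"
      using cont Suc.prems by (auto intro: continuous_on_subset)
    obtain q where q: "r \<le> q" "q \<le> s" "G q = (G r + G s) / 2"
    proof (cases "G r \<le> G s")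
      case True
      with IVT'[of G r "(G r + G s) / 2" s] Suc.prems cont' that show ?thesis by auto
    next
      case False
      with IVT2'[of G s "(G r + G s) / 2" r] Suc.prems cont' that show ?thesis by auto
    qed
    have "\<bar>g s - g r\<bar> \<le> \<bar>g s - g q\<bar> + \<bar>g q - g r\<bar>" by simp
    also have "\<dots> \<le> C * (G s - G q)\<^sup>2 / 2 ^ n + C * (G q - G r)\<^sup>2 / 2 ^ n"
      using Suc q by (intro add_mono Suc.IH) auto
    also have "\<dots> = C * (G s - G r)\<^sup>2 / 2 ^ Suc n"
      unfolding q by (simp add: field_simps power2_eq_square)
    finally show ?case .
  qed
  have "(\<lambda>n. C * (G v - G u)\<^sup>2 / 2 ^ n) \<longlonglongrightarrow> 0"
    by (intro LIMSEQ_divide_realpow_zero) simp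
  moreover have "\<And>n. \<bar>g v - g u\<bar> \<le> C * (G v - G u)\<^sup>2 / 2 ^ n"
    using bound \<open>u \<le> v\<close> by simp
  ultimately have "\<bar>g v - g u\<bar> \<le> 0"
    by (intro tendsto_lowerbound[where F=sequentially]) auto
  thus ?thesis by simp
qed

section \<open>The environment\<close>

lemma set_integral_increment:
  fixes f :: "real \<Rightarrow> real"
  assumes f: "set_integrable lborel {c..s} f" and "c \<le> r" "r \<le> s"
  shows "(LINT u:{r..s}|lborel. f u) = (LINT u:{c..s}|lborel. f u) - (LINT u:{c..r}|lborel. f u)"
proof -
  have un: "{c..s} = {c..r} \<union> {r..s}" using assms by auto
  have "(LINT u:{c..s}|lborel. f u) = (LINT u:{c..r}|lborel. f u) + (LINT u:{r..s}|lborel. f u)"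
    unfolding un
  proof (rule set_integral_Un_AE)
    show "AE u in lborel. \<not> (u \<in> {c..r} \<and> u \<in> {r..s})"
      using AE_lborel_singleton[of r] by eventually_elim auto
  qed (use assms in \<open>auto intro!: set_integrable_subset[OF f]\<close>)
  thus ?thesis by simp
qed

lemma continuous_on_set_integral:
  fixes f :: "real \<Rightarrow> real"
  assumes f: "set_integrable lborel {c..s} f"
  shows "continuous_on {c..s} (\<lambda>r. LINT u:{c..r}|lborel. f u)"
proof -
  have "continuous_on {c..s} (\<lambda>r. integral {c..r} f)"
    using set_borel_integral_eq_integral(1)[OF f] by (rule indefinite_integral_continuous_1)
  moreover have "integral {c..r} f = (LINT u:{c..r}|lborel. f u)" if "r \<in> {c..s}" for r
    using that by (subst set_borel_integral_eq_integral(2)) (auto intro!: set_integrable_subset[OF f])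
  ultimately show ?thesis by (rule continuous_on_eq)
qed

context theta_environment
begin

definition Lam :: "real \<Rightarrow> real" where
  "Lam t = (LINT u:{0..t}|lborel. lam u)"

definition births :: "real \<Rightarrow> real" where
  "births t = (LINT u:{0..t}|lborel. a u * lam u)"

text \<open>
  This is \<open>\<mu>\<^sub>t\<close> in its exponential form; that it equals the mean of \<open>Z t\<close> is a theorem
  about the process, proved in \<open>mean_size_eq\<close>.
\<close>

definition growth :: "real \<Rightarrow> real" where
  "growth t = exp (births t - Lam t)"

definition Vint :: "real \<Rightarrow> real" where
  "Vint t = \<theta> / (1 + \<theta>) * (LINT u:{0..t}|lborel. growth u powr (- \<theta>) * lam u)"

lemma weighted_lam_integrable:
  fixes f :: "real \<Rightarrow> real"
  assumes f: "f \<in> borel_measurable (restrict_space borel {r..s})" and "0 \<le> r"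
    and B: "\<And>u. r \<le> u \<Longrightarrow> u \<le> s \<Longrightarrow> \<bar>f u\<bar> \<le> B"
  shows "set_integrable lborel {r..s} (\<lambda>u. f u * lam u)"
proof (cases "r \<le> s")
  case True
  have B0: "0 \<le> B" using B[of r] True by force
  have lam: "set_integrable lborel {r..s} lam"
    using lam_integrable[of s] \<open>0 \<le> r\<close> True by (auto intro: set_integrable_subset)
  have "set_integrable lborel {r..s} (\<lambda>u. B * lam u)"
    using lam by simp
  thus ?thesis
  proof (rule set_integrable_bound)
    have "lam \<in> borel_measurable (restrict_space borel {r..s})"
      using lam_measurable by (rule measurable_restrict_mono) (use \<open>0 \<le> r\<close> in auto)
    with f have "(\<lambda>u. f u * lam u) \<in> borel_measurable (restrict_space borel {r..s})"
      by (rule borel_measurable_times)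
    thus "set_borel_measurable lborel {r..s} (\<lambda>u. f u * lam u)"
      unfolding set_borel_measurable_def by (subst (asm) borel_measurable_restrict_space_iff) auto
    show "AE u in lborel. u \<in> {r..s} \<longrightarrow> norm (f u * lam u) \<le> norm (B * lam u)"
      using B lam_nonneg \<open>0 \<le> r\<close> B0 by (intro AE_I2) (auto simp: abs_mult intro!: mult_right_mono)
  qed
qed (simp add: set_integrable_def)

lemma lam_set_integrable: "0 \<le> r \<Longrightarrow> set_integrable lborel {r..s} lam"
  using weighted_lam_integrable[of "\<lambda>_. 1" r s 1] by simp

lemma a_set_measurable: "0 \<le> r \<Longrightarrow> a \<in> borel_measurable (restrict_space borel {r..s})"
  using a_measurable by (rule measurable_restrict_mono) auto

lemma a_lam_set_integrable: "0 \<le> r \<Longrightarrow> set_integrable lborel {r..s} (\<lambda>u. a u * lam u)"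
  using a_range by (intro weighted_lam_integrable[where B="1 + 1/\<theta>"] a_set_measurable) auto

lemma Lam_increment:
  "0 \<le> r \<Longrightarrow> r \<le> s \<Longrightarrow> (LINT u:{r..s}|lborel. lam u) = Lam s - Lam r"
  unfolding Lam_def by (intro set_integral_increment lam_set_integrable) auto

lemma births_increment:
  "0 \<le> r \<Longrightarrow> r \<le> s \<Longrightarrow> (LINT u:{r..s}|lborel. a u * lam u) = births s - births r"
  unfolding births_def by (intro set_integral_increment a_lam_set_integrable) auto

lemma Lam_mono: "0 \<le> r \<Longrightarrow> r \<le> s \<Longrightarrow> Lam r \<le> Lam s"
  using Lam_increment[of r s] lam_nonneg
    set_integral_mono[of lborel "{r..s}" "\<lambda>_. 0" lam] lam_set_integrable[of r s]
  by (auto simp: set_integrable_def set_lebesgue_integral_def)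

lemma births_mono: "0 \<le> r \<Longrightarrow> r \<le> s \<Longrightarrow> births r \<le> births s"
  using births_increment[of r s] lam_nonneg a_range
    set_integral_mono[of lborel "{r..s}" "\<lambda>_. 0" "\<lambda>u. a u * lam u"] a_lam_set_integrable[of r s]
  by (auto simp: set_integrable_def set_lebesgue_integral_def)

lemma births_increment_le:
  assumes "0 \<le> r" "r \<le> s"
  shows "births s - births r \<le> (1 + 1/\<theta>) * (Lam s - Lam r)"
proof -
  have "births s - births r \<le> (LINT u:{r..s}|lborel. (1 + 1/\<theta>) * lam u)"
    unfolding births_increment[OF assms, symmetric]
    using assms a_range lam_nonneg
    by (intro set_integral_mono a_lam_set_integrable mult_right_mono) (auto intro: lam_set_integrable)
  also have "\<dots> = (1 + 1/\<theta>) * (Lam s - Lam r)"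
    using Lam_increment[OF assms] by (simp only: set_integral_mult_right)
  finally show ?thesis .
qed

lemma Lam_0 [simp]: "Lam 0 = 0" and births_0 [simp]: "births 0 = 0"
  and growth_0 [simp]: "growth 0 = 1" and Vint_0 [simp]: "Vint 0 = 0"
proof -
  have *: "(LINT u:{0..0}|lborel. f u) = 0" for f :: "real \<Rightarrow> real"
  proof -
    have "(LINT u:{0..0}|lborel. f u) = (LINT u:{}|lborel. f u)"
      by (rule set_integral_discrete_difference[where X="{0}"]) auto
    thus ?thesis by (simp add: set_lebesgue_integral_def)
  qed
  show "Lam 0 = 0" "births 0 = 0" "growth 0 = 1" "Vint 0 = 0"
    unfolding growth_def Vint_def Lam_def births_def * by simp_all
qed

lemma continuous_on_Lam: "continuous_on {0..t} Lam"
  unfolding Lam_def by (intro continuous_on_set_integral lam_set_integrable) simp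

lemma continuous_on_births: "continuous_on {0..t} births"
  unfolding births_def by (intro continuous_on_set_integral a_lam_set_integrable) simp

lemma continuous_on_growth: "continuous_on {0..t} growth"
  unfolding growth_def by (intro continuous_intros continuous_on_Lam continuous_on_births)

lemma growth_pos [simp]: "growth t > 0"
  by (simp add: growth_def)

lemma growth_weight_integrable:
  "0 \<le> t \<Longrightarrow> set_integrable lborel {0..t} (\<lambda>u. growth u powr (- \<theta>) * lam u)"
proof -
  assume "0 \<le> t"
  have cont: "continuous_on {0..t} (\<lambda>u. growth u powr (- \<theta>))"
    using growth_pos by (intro continuous_intros continuous_on_growth) (auto simp: less_imp_neq[symmetric])
  hence "compact ((\<lambda>u. growth u powr (- \<theta>)) ` {0..t})"
    by (rule compact_continuous_image) simp
  then obtain B where "\<forall>y \<in> (\<lambda>u. growth u powr (- \<theta>)) ` {0..t}. norm y \<le> B"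
    using compact_imp_bounded bounded_iff by metis
  thus ?thesis
    by (intro weighted_lam_integrable[where B=B] borel_measurable_continuous_on_restrict cont) auto
qed

lemma Vint_increment:
  assumes "0 \<le> r" "r \<le> s"
  shows "Vint s - Vint r = \<theta> / (1 + \<theta>) * (LINT u:{r..s}|lborel. growth u powr (- \<theta>) * lam u)"
  using set_integral_increment[OF growth_weight_integrable[of s] assms] assms
  by (simp add: Vint_def right_diff_distrib)

lemma Vint_nonneg: "0 \<le> t \<Longrightarrow> 0 \<le> Vint t"
  unfolding Vint_def set_lebesgue_integral_def using theta_range lam_nonneg
  by (auto intro!: mult_nonneg_nonneg divide_nonneg_nonneg Bochner_Integration.integral_nonneg split: split_indicator)

text \<open>
  The offspring generating function at time \<open>t\<close> is \<open>1 - a t * defect s\<close>: the environment enters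
  only through the scalar factor \<open>a t\<close>. Hence the offspring probabilities have the form
  \<open>(if k = 0 then 1 else 0) - a t * defect_coeff k\<close> with coefficients that do not depend on \<open>t\<close>. They
  are therefore measurable in \<open>t\<close>, and integrating them against the death rate amounts to integrating
  \<open>lam\<close> and \<open>a * lam\<close>.
\<close>

definition defect :: "real \<Rightarrow> real" where
  "defect s = (1 - s) - (1 - s) powr (1 + \<theta>) / (1 + \<theta>)"

definition defect_coeff :: "nat \<Rightarrow> real" where
  "defect_coeff k = (if k = 0 then 1 else if k = 1 then -1 else 0)
     - (1 / (1 + \<theta>)) * ((1 + \<theta>) gchoose k) * (-1) ^ k"

lemma defect_sums:
  assumes "0 \<le> s" "s < 1"
  shows "(\<lambda>k. defect_coeff k * s ^ k) sums defect s"
proof -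
  have "(\<lambda>k. if k \<in> {0, 1} then (if k = 0 then 1 else - s) else 0) sums (\<Sum>k\<in>{0::nat,1}. if k = 0 then 1 else - s)"
    by (rule sums_If_finite_set) simp
  moreover have "(\<lambda>k. ((1 + \<theta>) gchoose k) * (- s) ^ k) sums (1 + - s) powr (1 + \<theta>)"
    by (rule gen_binomial_real) (use assms in auto)
  hence "(\<lambda>k. 1 / (1 + \<theta>) * (((1 + \<theta>) gchoose k) * (- s) ^ k)) sums (1 / (1 + \<theta>) * (1 + - s) powr (1 + \<theta>))"
    by (rule sums_mult)
  ultimately have "(\<lambda>k. (if k \<in> {0, 1} then (if k = 0 then 1 else - s) else 0) -
       1 / (1 + \<theta>) * (((1 + \<theta>) gchoose k) * (- s) ^ k)) sums
     ((\<Sum>k\<in>{0::nat,1}. if k = 0 then 1 else - s) - 1 / (1 + \<theta>) * (1 + - s) powr (1 + \<theta>))"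
    by (rule sums_diff)
  moreover have "(if k \<in> {0, 1} then (if k = 0 then 1 else - s) else 0) -
       1 / (1 + \<theta>) * (((1 + \<theta>) gchoose k) * (- s) ^ k) = defect_coeff k * s ^ k" for k
    by (auto simp: defect_coeff_def algebra_simps power_minus[of s])
  ultimately show ?thesis by (simp add: defect_def)
qed

lemma pmf_offspring:
  assumes "0 \<le> t"
  shows "pmf (p t) k = (if k = 0 then 1 else 0) - a t * defect_coeff k"
proof (rule power_series_unique)
  fix s :: real assume s: "0 < s" "s < 1"
  show "(\<lambda>k. pmf (p t) k * s ^ k) sums (1 - a t * defect s)"
    using pgf_sums[of s "p t"] s offspring_pgf[OF assms, of s]
    by (auto simp: sums_iff defect_def algebra_simps)
  have "(\<lambda>k. (if k = 0 then 1 else 0)) sums (1::real)"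
    using sums_If_finite_set[of "{0::nat}" "\<lambda>_. 1::real"] by simp
  hence "(\<lambda>k. (if k = 0 then 1 else 0) - a t * (defect_coeff k * s ^ k)) sums (1 - a t * defect s)"
    by (intro sums_diff sums_mult defect_sums) (use s in auto)
  moreover have "(if k = 0 then 1 else 0) - a t * (defect_coeff k * s ^ k) =
      ((if k = 0 then 1 else 0) - a t * defect_coeff k) * s ^ k" for k
    by (auto simp: algebra_simps)
  ultimately show "(\<lambda>k. ((if k = 0 then 1 else 0) - a t * defect_coeff k) * s ^ k) sums (1 - a t * defect s)"
    by simp
qed

lemma pmf_offspring_measurable:
  assumes "0 \<le> r"
  shows "(\<lambda>u. pmf (p u) k) \<in> borel_measurable (restrict_space borel {r..s})"
proof -
  have "(\<lambda>u. (if k = 0 then 1 else 0) - a u * defect_coeff k) \<in> borel_measurable (restrict_space borel {r..s})"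
    by (intro borel_measurable_diff borel_measurable_times a_set_measurable assms) auto
  thus ?thesis
    by (rule measurable_cong[THEN iffD1, rotated]) (use assms in \<open>auto simp: pmf_offspring\<close>)
qed

lemma offspring_mass:
  assumes "0 \<le> r" "r \<le> s"
  shows "(LINT u:{r..s}|lborel. pmf (p u) k * lam u) =
     (if k = 0 then Lam s - Lam r else 0) - (births s - births r) * defect_coeff k"
proof -
  have "(LINT u:{r..s}|lborel. pmf (p u) k * lam u) =
     (LINT u:{r..s}|lborel. (if k = 0 then 1 else 0) * lam u - (a u * lam u) * defect_coeff k)"
    by (rule set_lebesgue_integral_cong) (use assms in \<open>auto simp: pmf_offspring algebra_simps\<close>)
  also have "\<dots> = (LINT u:{r..s}|lborel. (if k = 0 then 1 else 0) * lam u) -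
     (LINT u:{r..s}|lborel. (a u * lam u) * defect_coeff k)"
    by (intro set_integral_diff)
       (use assms lam_set_integrable[of r s] a_lam_set_integrable[of r s] in \<open>auto\<close>)
  also have "\<dots> = (if k = 0 then Lam s - Lam r else 0) - (births s - births r) * defect_coeff k"
    unfolding set_integral_mult_left set_integral_mult_right using assms
    by (simp add: Lam_increment births_increment)
  finally show ?thesis .
qed

text \<open>
  Replacing the survival factor up to the death time by its value at the end of the interval loses
  only a factor that tends to \<open>1\<close> as the interval shrinks.
\<close>

lemma discounted_offspring_mass_ge:
  assumes "0 \<le> r" "r \<le> s"
  shows "exp (- (Lam s - Lam r)) * (LINT u:{r..s}|lborel. pmf (p u) k * lam u) \<le>
    (LINT u:{r..s}|lborel. exp (- (LINT v:{r..u}|lborel. lam v)) * lam u * pmf (p u) k)"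
proof -
  have cont: "continuous_on {r..s} (\<lambda>u. exp (- (Lam u - Lam r)))"
    by (intro continuous_intros continuous_on_subset[OF continuous_on_Lam]) (use assms in auto)
  have "exp (- (Lam s - Lam r)) * (LINT u:{r..s}|lborel. pmf (p u) k * lam u) =
     (LINT u:{r..s}|lborel. exp (- (Lam s - Lam r)) * (pmf (p u) k * lam u))"
    by (simp only: set_integral_mult_right)
  also have "\<dots> \<le> (LINT u:{r..s}|lborel. (exp (- (Lam u - Lam r)) * pmf (p u) k) * lam u)"
  proof (rule set_integral_mono)
    show "set_integrable lborel {r..s} (\<lambda>u. exp (- (Lam s - Lam r)) * (pmf (p u) k * lam u))"
      by (intro set_integrable_mult_right weighted_lam_integrable[where B=1] pmf_offspring_measurable)
        (use assms in \<open>auto simp: pmf_le_1\<close>)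
    show "set_integrable lborel {r..s} (\<lambda>u. exp (- (Lam u - Lam r)) * pmf (p u) k * lam u)"
    proof (rule weighted_lam_integrable[where B=1])
      show "(\<lambda>u. exp (- (Lam u - Lam r)) * pmf (p u) k) \<in> borel_measurable (restrict_space borel {r..s})"
        by (intro borel_measurable_times pmf_offspring_measurable
              borel_measurable_continuous_on_restrict cont assms)
      show "\<bar>exp (- (Lam u - Lam r)) * pmf (p u) k\<bar> \<le> 1" if "r \<le> u" "u \<le> s" for u
        using mult_le_one[of "exp (- (Lam u - Lam r))" "pmf (p u) k"] Lam_mono[of r u] assms that
        by (simp add: abs_mult pmf_le_1)
    qed (use assms in auto)
    show "exp (- (Lam s - Lam r)) * (pmf (p u) k * lam u) \<le> exp (- (Lam u - Lam r)) * pmf (p u) k * lam u"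
      if "u \<in> {r..s}" for u
      using that Lam_mono[of u s] assms lam_nonneg[of u]
      by (simp only: mult.assoc) (intro mult_right_mono, auto)
  qed
  also have "\<dots> = (LINT u:{r..s}|lborel. exp (- (LINT v:{r..u}|lborel. lam v)) * lam u * pmf (p u) k)"
    by (rule set_lebesgue_integral_cong) (use assms in \<open>auto simp: Lam_increment\<close>)
  finally show ?thesis .
qed

lemma defect_deriv:
  assumes "s < 1"
  shows "(defect has_real_derivative ((1 - s) powr \<theta> - 1)) (at s)"
proof -
  have "((\<lambda>s. (1 - s) - (1 - s) powr (1 + \<theta>) / (1 + \<theta>)) has_real_derivative
      (0 - 1) - ((1 + \<theta>) * (1 - s) powr (1 + \<theta> - 1) * (0 - 1)) / (1 + \<theta>)) (at s)"
    using assms theta_range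
    by (intro DERIV_diff DERIV_cdivide has_real_derivative_powr[THEN DERIV_chain2] DERIV_const DERIV_ident) auto
  moreover have "(0 - 1) - ((1 + \<theta>) * (1 - s) powr (1 + \<theta> - 1) * (0 - 1)) / (1 + \<theta>) = (1 - s) powr \<theta> - 1"
    using theta_range by simp
  ultimately show ?thesis by (simp add: defect_def[abs_def])
qed

lemma defect_Lipschitz:
  assumes "0 \<le> r" "r \<le> s" "s < 1"
  shows "defect s \<le> defect r" "defect r - defect s \<le> s - r"
proof -
  show "defect s \<le> defect r"
    by (rule DERIV_nonpos_imp_nonincreasing[OF assms(2)])
       (use assms theta_range in \<open>auto intro!: exI[of _ "(1 - _) powr \<theta> - 1"] defect_deriv simp: powr_le1\<close>)
  have "defect r + r \<le> defect s + s"
    by (rule DERIV_nonneg_imp_nondecreasing[OF assms(2)])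
       (use assms theta_range in \<open>auto intro!: exI[of _ "(1 - _) powr \<theta>"] derivative_eq_intros defect_deriv\<close>)
  thus "defect r - defect s \<le> s - r" by simp
qed

lemma defect_nonneg: "0 \<le> s \<Longrightarrow> s \<le> 1 \<Longrightarrow> 0 \<le> defect s"
  using powr_mono'[of 1 "1 + \<theta>" "1 - s"] theta_range
    frac_le[of "1 - s" "(1 - s) powr (1 + \<theta>)" 1 "1 + \<theta>"]
  by (auto simp: defect_def)

lemma defect_le: "s \<le> 1 \<Longrightarrow> defect s \<le> 1 - s"
  using theta_range by (simp add: defect_def)

end

section \<open>Transition kernels and the first death\<close>

text \<open>
  A form of Fatou's lemma for an arbitrary set \<open>E\<close>, on which \<open>measure\<close> has the default value \<open>0\<close>
  outside the sigma-algebra. It will be applied to events that involve a whole piece of a path.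
\<close>

lemma (in finite_measure) measure_le_if_eventually_in:
  assumes U: "\<And>n. U n \<in> sets M" "\<And>n. measure M (U n) \<le> b"
    and E: "\<And>\<omega>. \<omega> \<in> E \<Longrightarrow> eventually (\<lambda>n. \<omega> \<in> U n) sequentially"
  shows "measure M E \<le> b"
proof -
  define V where "V n = (\<Inter>m\<in>{n..}. U m)" for n :: nat
  have V [measurable]: "V n \<in> sets M" for n
    unfolding V_def using U by (intro sets.countable_INT') auto
  have "incseq V"
    unfolding V_def incseq_def by auto
  hence "(\<lambda>n. measure M (V n)) \<longlonglongrightarrow> measure M (\<Union>n. V n)"
    using V by (intro finite_Lim_measure_incseq) auto
  moreover have "measure M (V n) \<le> b" for n
    by (rule order_trans[OF finite_measure_mono U(2)[of n]]) (use U(1) in \<open>auto simp: V_def\<close>)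
  ultimately have "measure M (\<Union>n. V n) \<le> b"
    by (intro LIMSEQ_le_const2) auto
  moreover have "measure M E \<le> measure M (\<Union>n. V n)"
  proof (rule finite_measure_mono)
    show "E \<subseteq> (\<Union>n. V n)"
    proof
      fix \<omega> assume "\<omega> \<in> E"
      then obtain N where "\<forall>n\<ge>N. \<omega> \<in> U n"
        using E unfolding eventually_sequentially by blast
      thus "\<omega> \<in> (\<Union>n. V n)" by (auto simp: V_def)
    qed
  qed (use V in auto)
  ultimately show ?thesis by simp
qed

lemma past_event:
  assumes "0 \<le> u" "u \<le> s"
  shows "{\<omega> \<in> space M. Z u \<omega> = n} \<in> past_events M Z s"
  unfolding past_events_def using assms by (intro sigma_sets.Basic) blast

lemma past_events_finite_INT:
  assumes "finite I" "\<And>i. i \<in> I \<Longrightarrow> 0 \<le> \<tau> i" "\<And>i. i \<in> I \<Longrightarrow> \<tau> i \<le> s"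
  shows "{\<omega> \<in> space M. \<forall>i\<in>I. Z (\<tau> i) \<omega> = n i} \<in> past_events M Z s"
proof -
  interpret sigma_algebra "space M" "past_events M Z s"
    unfolding past_events_def by (rule sigma_algebra_sigma_sets) auto
  show ?thesis
    using assms by (intro sets_Collect_finite_All past_event) auto
qed

context theta_positive_bpve
begin

definition kernel :: "real \<Rightarrow> real \<Rightarrow> nat pmf" where
  "kernel = (SOME K. \<forall>s t n j. \<forall>A \<in> past_events M Z s. 0 \<le> s \<longrightarrow> s \<le> t \<longrightarrow>
        measure M (A \<inter> {\<omega> \<in> space M. Z s \<omega> = n \<and> Z t \<omega> = j}) =
        measure M (A \<inter> {\<omega> \<in> space M. Z s \<omega> = n}) * pmf (iid_sum_pmf n (K s t)) j)"

lemma markov: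
  assumes "A \<in> past_events M Z s" "0 \<le> s" "s \<le> t"
  shows "measure M (A \<inter> {\<omega> \<in> space M. Z s \<omega> = n \<and> Z t \<omega> = j}) =
        measure M (A \<inter> {\<omega> \<in> space M. Z s \<omega> = n}) * pmf (iid_sum_pmf n (kernel s t)) j"
  using someI_ex[OF branching[unfolded markov_branching_def], folded kernel_def] assms by blast

lemma Z_event [measurable]: "0 \<le> t \<Longrightarrow> {\<omega> \<in> space M. P (Z t \<omega>)} \<in> sets M"
  using measurable_sets[OF Z_measurable, of t "Collect P"]
  by (simp add: vimage_def Int_def conj_commute)

lemma past_space: "space M \<in> past_events M Z s"
  unfolding past_events_def by (rule sigma_sets_top)

lemma kernel_law:
  assumes "0 \<le> s" "s \<le> t"
  shows "measure M {\<omega> \<in> space M. Z s \<omega> = 1 \<and> Z t \<omega> = j} =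
    measure M {\<omega> \<in> space M. Z s \<omega> = 1} * pmf (kernel s t) j"
  using markov[OF past_space assms, of 1 j] by (simp add: Int_def cong: conj_cong)

lemma Z_law:
  assumes "0 \<le> t"
  shows "measure M {\<omega> \<in> space M. Z t \<omega> = j} = pmf (kernel 0 t) j"
proof -
  have "{\<omega> \<in> space M. Z 0 \<omega> = 1} = space M"
    "{\<omega> \<in> space M. Z 0 \<omega> = 1 \<and> Z t \<omega> = j} = {\<omega> \<in> space M. Z t \<omega> = j}"
    using Z_initial by auto
  with kernel_law[of 0 t j] assms show ?thesis by (simp add: prob_space)
qed

lemma prob_one_pos:
  assumes "0 \<le> s"
  shows "0 < measure M {\<omega> \<in> space M. Z s \<omega> = 1}"
proof -
  have "{\<omega> \<in> space M. Z 0 \<omega> = 1} = space M" using Z_initial by auto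
  hence "0 < measure M {\<omega> \<in> space M. \<forall>u\<in>{0..s}. Z u \<omega> = 1}"
    using lifetime[of 0 s] assms by (simp add: prob_space)
  also have "\<dots> \<le> measure M {\<omega> \<in> space M. Z s \<omega> = 1}"
    using assms by (intro finite_measure_mono) auto
  finally show ?thesis .
qed

text \<open>
  An individual that does not die is still alone at the end; with the lifetime law this bounds the
  probability of population size one from below.
\<close>

lemma kernel_one_ge:
  assumes "0 \<le> s" "s \<le> t"
  shows "exp (- (Lam t - Lam s)) \<le> pmf (kernel s t) 1"
proof -
  have "measure M {\<omega> \<in> space M. \<forall>u\<in>{s..t}. Z u \<omega> = 1} \<le> measure M {\<omega> \<in> space M. Z s \<omega> = 1 \<and> Z t \<omega> = 1}"
    using assms by (intro finite_measure_mono) auto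
  thus ?thesis
    unfolding kernel_law[OF assms] lifetime[OF assms] Lam_increment[OF assms]
    using prob_one_pos[OF assms(1)] by (simp add: mult_le_cancel_left)
qed

lemma chapman_kolmogorov:
  assumes "0 \<le> s" "s \<le> r" "r \<le> t"
  shows "kernel s t = bind_pmf (kernel s r) (\<lambda>n. iid_sum_pmf n (kernel r t))"
proof (rule pmf_eqI)
  fix j
  let ?P = "measure M {\<omega> \<in> space M. Z s \<omega> = 1}"
  let ?A = "{\<omega> \<in> space M. Z s \<omega> = 1}"
  have A: "?A \<in> past_events M Z r"
    using assms by (intro past_event) auto
  define F where "F n = ?A \<inter> {\<omega> \<in> space M. Z r \<omega> = n \<and> Z t \<omega> = j}" for n
  have "(\<lambda>n. measure M (F n)) sums measure M (\<Union>n. F n)"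
    unfolding F_def using assms by (intro finite_measure_UNION) (auto simp: disjoint_family_on_def)
  also have "(\<Union>n. F n) = {\<omega> \<in> space M. Z s \<omega> = 1 \<and> Z t \<omega> = j}"
    by (auto simp: F_def)
  also have "measure M \<dots> = ?P * pmf (kernel s t) j"
    using assms by (intro kernel_law) auto
  also have "(\<lambda>n. measure M (F n)) = (\<lambda>n. ?P * (pmf (kernel s r) n * pmf (iid_sum_pmf n (kernel r t)) j))"
  proof
    fix n
    have "?A \<inter> {\<omega> \<in> space M. Z r \<omega> = n} = {\<omega> \<in> space M. Z s \<omega> = 1 \<and> Z r \<omega> = n}" by auto
    thus "measure M (F n) = ?P * (pmf (kernel s r) n * pmf (iid_sum_pmf n (kernel r t)) j)"
      unfolding F_def using markov[OF A, of t n j] assms kernel_law[of s r n] by simp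
  qed
  finally have 1: "(\<lambda>n. ?P * (pmf (kernel s r) n * pmf (iid_sum_pmf n (kernel r t)) j)) sums (?P * pmf (kernel s t) j)" .
  have "(\<lambda>n. pmf (kernel s r) n * pmf (iid_sum_pmf n (kernel r t)) j) sums
     pmf (bind_pmf (kernel s r) (\<lambda>n. iid_sum_pmf n (kernel r t))) j"
    unfolding pmf_bind
    by (intro expectation_pmf_sums measure_pmf.integrable_const_bound[where B=1]) (auto simp: pmf_le_1)
  from sums_unique2[OF sums_mult[OF this] 1]
  show "pmf (kernel s t) j = pmf (bind_pmf (kernel s r) (\<lambda>n. iid_sum_pmf n (kernel r t))) j"
    using prob_one_pos[OF assms(1)] by simp
qed

text \<open>
  By right continuity the path stays at \<open>k\<close> for a while after the first death. Once the mesh is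
  shorter than that while, the first grid point at or after the death sees the value \<open>k\<close>, and all
  earlier grid points see the value \<open>1\<close>.
\<close>

lemma first_death_on_grid:
  assumes u: "s < u" "u \<le> t" and before: "\<And>v. s \<le> v \<Longrightarrow> v < u \<Longrightarrow> Z v \<omega> = 1" and "Z u \<omega> = k"
    and \<omega>: "\<omega> \<in> space M" and s: "0 \<le> s"
  shows "\<forall>\<^sub>F n in sequentially. \<exists>i\<in>{1..Suc n}.
    (\<forall>j<i. Z (s + real j * ((t - s) / real (Suc n))) \<omega> = 1) \<and> Z (s + real i * ((t - s) / real (Suc n))) \<omega> = k"
proof -
  have "((\<lambda>v. Z v \<omega>) \<longlongrightarrow> Z u \<omega>) (at_right u)"
    using Z_right_continuous[OF \<omega>, of u] u s by (simp add: continuous_within)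
  hence "eventually (\<lambda>v. Z v \<omega> = k) (at_right u)"
    using \<open>Z u \<omega> = k\<close> by (simp add: tendsto_discrete)
  then obtain d where d: "d > u" "\<And>v. u < v \<Longrightarrow> v < d \<Longrightarrow> Z v \<omega> = k"
    by (auto simp: eventually_at_right_field)
  have "(\<lambda>n. (t - s) / real (Suc n)) \<longlonglongrightarrow> 0"
    by (rule LIMSEQ_Suc[OF lim_const_over_n])
  hence "eventually (\<lambda>n. (t - s) / real (Suc n) < d - u) sequentially"
    using d(1) by (intro order_tendstoD(2)) auto
  thus ?thesis
  proof eventually_elim
    case (elim n)
    define h where "h = (t - s) / real (Suc n)"
    have h: "0 < h" "h < d - u" "real (Suc n) * h = t - s"
      using elim u by (auto simp: h_def)
    define i where "i = (LEAST i. u \<le> s + real i * h)"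
    have ex: "u \<le> s + real (Suc n) * h" using h u by simp
    have i: "u \<le> s + real i * h" "i \<le> Suc n"
      unfolding i_def using ex by (rule LeastI, rule Least_le)
    have less: "s + real j * h < u" if "j < i" for j
      using not_less_Least[of j "\<lambda>i. u \<le> s + real i * h"] that unfolding i_def by simp
    have "i \<noteq> 0" using i(1) u by (intro notI) simp
    hence "s + real (i - 1) * h < u" by (intro less) simp
    hence "s + real i * h < d" using h \<open>i \<noteq> 0\<close> by (simp add: of_nat_diff algebra_simps)
    hence "Z (s + real i * h) \<omega> = k"
      using i(1) d(2) \<open>Z u \<omega> = k\<close> by (cases "s + real i * h = u") auto
    moreover have "Z (s + real j * h) \<omega> = 1" if "j < i" for j
      using less[OF that] h by (intro before) auto
    ultimately show ?case
      unfolding h_def[symmetric] using i(2) \<open>i \<noteq> 0\<close> by (intro bexI[of _ i]) auto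
  qed
qed

text \<open>
  This takes the place of the strong Markov property at the first death. On a grid, the event that
  the first grid point with a value other than \<open>1\<close> has value \<open>k\<close> splits according to that grid point,
  and the ordinary Markov property applies at each of them: the \<open>k\<close> individuals all survive until \<open>t\<close>
  with probability at least \<open>exp (- (Lam t - Lam s)) ^ k\<close>. Refining the grid captures every path
  whose first death leaves \<open>k\<close> individuals.
\<close>

lemma kernel_ge_first_death:
  assumes st: "0 \<le> s" "s \<le> t" and k: "k \<noteq> 1"
  shows "exp (- (Lam t - Lam s)) ^ k *
      measure M {\<omega> \<in> space M. \<exists>u\<in>{s<..t}. (\<forall>v\<in>{s..<u}. Z v \<omega> = 1) \<and> Z u \<omega> = k}
    \<le> measure M {\<omega> \<in> space M. Z s \<omega> = 1} * pmf (kernel s t) k"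
proof -
  define z where "z = exp (- (Lam t - Lam s))"
  let ?E = "{\<omega> \<in> space M. \<exists>u\<in>{s<..t}. (\<forall>v\<in>{s..<u}. Z v \<omega> = 1) \<and> Z u \<omega> = k}"
  let ?b = "measure M {\<omega> \<in> space M. Z s \<omega> = 1 \<and> Z t \<omega> = k}"
  define \<tau> where "\<tau> n i = s + real i * ((t - s) / real (Suc n))" for n i
  have \<tau>_le: "s \<le> \<tau> n i" for n i
    using st by (simp add: \<tau>_def)
  have \<tau>_mono: "\<tau> n j \<le> \<tau> n i" if "j \<le> i" for n i j
    using that st by (auto simp: \<tau>_def intro!: mult_right_mono divide_right_mono)
  have \<tau>_t: "\<tau> n (Suc n) = t" for n
    by (simp add: \<tau>_def)
  define A where "A n i = {\<omega> \<in> space M. \<forall>j\<in>{..<i}. Z (\<tau> n j) \<omega> = 1}" for n i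
  define F where "F n i = A n i \<inter> {\<omega> \<in> space M. Z (\<tau> n i) \<omega> = k}" for n i
  define U where "U n = (\<Union>i\<in>{1..Suc n}. F n i)" for n
  have A_past: "A n i \<in> past_events M Z (\<tau> n i)" for n i
    unfolding A_def using \<tau>_le[of n] \<tau>_mono[of _ i n] st
    by (intro past_events_finite_INT) (auto intro: order_trans)
  have A_sets [measurable]: "A n i \<in> sets M" for n i
    unfolding A_def
    by (intro sets.sets_Collect_finite_All Z_event order_trans[OF st(1) \<tau>_le]) auto
  have F_sets [measurable]: "F n i \<in> sets M" for n i
    unfolding F_def using \<tau>_le[of n i] st by (intro sets.Int A_sets Z_event) auto
  have U_sets: "U n \<in> sets M" for n
    unfolding U_def by auto
  have disj: "disjoint_family_on (F n) {1..Suc n}" for n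
    unfolding disjoint_family_on_def
  proof (intro ballI impI)
    fix i j assume ij: "i \<in> {1..Suc n}" "j \<in> {1..Suc n}" "i \<noteq> j"
    thus "F n i \<inter> F n j = {}"
      using k by (cases i j rule: linorder_cases) (auto simp: F_def A_def)
  qed
  have F_bound: "measure M (F n i) * z ^ k \<le> measure M (F n i \<inter> {\<omega> \<in> space M. Z t \<omega> = k})"
    if "i \<in> {1..Suc n}" for n i
  proof -
    have i: "0 \<le> \<tau> n i" "\<tau> n i \<le> t"
      using \<tau>_le[of n i] \<tau>_mono[of i "Suc n" n] \<tau>_t[of n] that st by auto
    have "z \<le> exp (- (Lam t - Lam (\<tau> n i)))"
      unfolding z_def using Lam_mono[of s "\<tau> n i"] \<tau>_le[of n i] st by simp
    also have "\<dots> \<le> pmf (kernel (\<tau> n i) t) 1"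
      using i by (intro kernel_one_ge)
    finally have "z ^ k \<le> pmf (kernel (\<tau> n i) t) 1 ^ k"
      by (intro power_mono) (auto simp: z_def)
    also have "\<dots> \<le> pmf (iid_sum_pmf k (kernel (\<tau> n i) t)) k"
      by (rule pmf_iid_sum_unchanged)
    finally have "measure M (F n i) * z ^ k \<le> measure M (F n i) * pmf (iid_sum_pmf k (kernel (\<tau> n i) t)) k"
      by (intro mult_left_mono) auto
    also have "\<dots> = measure M (A n i \<inter> {\<omega> \<in> space M. Z (\<tau> n i) \<omega> = k \<and> Z t \<omega> = k})"
      unfolding F_def using markov[OF A_past i] by simp
    also have "A n i \<inter> {\<omega> \<in> space M. Z (\<tau> n i) \<omega> = k \<and> Z t \<omega> = k} = F n i \<inter> {\<omega> \<in> space M. Z t \<omega> = k}"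
      by (auto simp: F_def)
    finally show ?thesis .
  qed
  have U_bound: "measure M (U n) \<le> ?b / z ^ k" for n
  proof -
    let ?T = "{\<omega> \<in> space M. Z t \<omega> = k}"
    have T [measurable]: "?T \<in> sets M" using st by (intro Z_event) auto
    have "measure M (U n) * z ^ k = (\<Sum>i\<in>{1..Suc n}. measure M (F n i) * z ^ k)"
      unfolding U_def sum_distrib_right[symmetric]
      by (subst finite_measure_finite_Union) (use disj in auto)
    also have "\<dots> \<le> (\<Sum>i\<in>{1..Suc n}. measure M (F n i \<inter> ?T))"
      by (intro sum_mono F_bound)
    also have "\<dots> = measure M (\<Union>i\<in>{1..Suc n}. F n i \<inter> ?T)"
      by (subst finite_measure_finite_Union) (use disj in \<open>auto simp: disjoint_family_on_def\<close>)
    also have "\<dots> \<le> ?b"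
    proof (rule finite_measure_mono)
      show "(\<Union>i\<in>{1..Suc n}. F n i \<inter> ?T) \<subseteq> {\<omega> \<in> space M. Z s \<omega> = 1 \<and> Z t \<omega> = k}"
      proof
        fix \<omega> assume "\<omega> \<in> (\<Union>i\<in>{1..Suc n}. F n i \<inter> ?T)"
        then obtain i where "1 \<le> i" "\<omega> \<in> A n i" "\<omega> \<in> ?T" by (auto simp: F_def)
        moreover from this have "Z (\<tau> n 0) \<omega> = 1" by (auto simp: A_def)
        ultimately show "\<omega> \<in> {\<omega> \<in> space M. Z s \<omega> = 1 \<and> Z t \<omega> = k}"
          by (simp add: \<tau>_def)
      qed
      show "{\<omega> \<in> space M. Z s \<omega> = 1 \<and> Z t \<omega> = k} \<in> sets M"
        using sets.Int[OF Z_event[of s "\<lambda>n. n = 1"] T] st by (simp add: Int_def conj_ac cong: conj_cong)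
    qed
    finally show ?thesis by (simp add: field_simps z_def)
  qed
  have "measure M ?E \<le> ?b / z ^ k"
  proof (rule measure_le_if_eventually_in[OF U_sets U_bound])
    fix \<omega> assume "\<omega> \<in> ?E"
    then obtain u where u: "s < u" "u \<le> t" "\<And>v. s \<le> v \<Longrightarrow> v < u \<Longrightarrow> Z v \<omega> = 1" "Z u \<omega> = k" "\<omega> \<in> space M"
      by auto
    have "\<forall>\<^sub>F n in sequentially. \<exists>i\<in>{1..Suc n}. (\<forall>j<i. Z (\<tau> n j) \<omega> = 1) \<and> Z (\<tau> n i) \<omega> = k"
      unfolding \<tau>_def by (rule first_death_on_grid[OF u st(1)])
    thus "\<forall>\<^sub>F n in sequentially. \<omega> \<in> U n"
      by eventually_elim (use u in \<open>auto simp: U_def F_def A_def\<close>)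
  qed
  thus ?thesis
    unfolding kernel_law[OF st] z_def[symmetric] by (simp add: field_simps z_def)
qed

lemma kernel_ge:
  assumes st: "0 \<le> s" "s \<le> t" and k: "k \<noteq> 1"
  shows "exp (- (Lam t - Lam s)) ^ Suc k * (LINT u:{s..t}|lborel. pmf (p u) k * lam u)
    \<le> pmf (kernel s t) k"
proof -
  let ?P = "measure M {\<omega> \<in> space M. Z s \<omega> = 1}" and ?z = "exp (- (Lam t - Lam s))"
  let ?I = "LINT u:{s..t}|lborel. exp (- (LINT v:{s..u}|lborel. lam v)) * lam u * pmf (p u) k"
  have "?P * (?z ^ k * ?I) \<le> ?P * pmf (kernel s t) k"
    using kernel_ge_first_death[OF assms] offspring[OF assms] by (simp add: ac_simps)
  hence "?z ^ k * ?I \<le> pmf (kernel s t) k"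
    using prob_one_pos[OF st(1)] by (simp add: mult_le_cancel_left)
  moreover have "?z ^ k * (?z * (LINT u:{s..t}|lborel. pmf (p u) k * lam u)) \<le> ?z ^ k * ?I"
    using discounted_offspring_mass_ge[OF st] by (intro mult_left_mono) auto
  ultimately show ?thesis
    unfolding power_Suc2 mult.assoc by (rule order_trans[rotated])
qed

end

section \<open>One step of the backward evolution\<close>

context theta_positive_bpve
begin

lemma offspring_mass_sums:
  assumes st: "0 \<le> s" "s \<le> t" and x: "0 \<le> x" "x < 1 \<or> Lam s = Lam t \<and> births s = births t"
  shows "(\<lambda>k. (LINT u:{s..t}|lborel. pmf (p u) k * lam u) * x ^ k) sums
    ((Lam t - Lam s) - (births t - births s) * defect x)"
proof (cases "Lam s = Lam t \<and> births s = births t")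
  case True
  thus ?thesis by (simp add: offspring_mass[OF st] cong: if_cong)
next
  case False
  hence "x < 1" using x by auto
  have "(\<lambda>k. (if k = 0 then 1 else 0)) sums (1::real)"
    using sums_If_finite_set[of "{0::nat}" "\<lambda>_. 1::real"] by simp
  hence "(\<lambda>k. (Lam t - Lam s) * (if k = 0 then 1 else 0) - (births t - births s) * (defect_coeff k * x ^ k)) sums
     ((Lam t - Lam s) * 1 - (births t - births s) * defect x)"
    by (intro sums_diff sums_mult defect_sums x \<open>x < 1\<close>)
  moreover have "(Lam t - Lam s) * (if k = 0 then 1 else 0) - (births t - births s) * (defect_coeff k * x ^ k) =
     (LINT u:{s..t}|lborel. pmf (p u) k * lam u) * x ^ k" for k
    unfolding offspring_mass[OF st] by (auto simp: algebra_simps)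
  ultimately show ?thesis by simp
qed

text \<open>
  The first-death estimates give lower bounds \<open>b k\<close> for all the probabilities of the kernel, and these
  bounds already add up to \<open>1\<close> minus a quantity of order \<open>L\<^sup>2\<close>. Being lower bounds, they are therefore
  exact up to that order: the missing mass bounds the error of the generating function. What remains is to expand the generating function \<open>S\<close> of the \<open>b k\<close>,
  which is explicit, in powers of \<open>L\<close>.
\<close>

lemma kernel_expansion:
  assumes st: "0 \<le> s" "s \<le> t" and y: "0 \<le> y" "y < 1"
  defines "L \<equiv> Lam t - Lam s" and "A \<equiv> births t - births s"
  shows "\<bar>pgf (kernel s t) y - (y + L * (1 - y) - A * defect y)\<bar> \<le> (5 + 2 / \<theta>) * L\<^sup>2"
proof -
  define c where "c = 1 + 1 / \<theta>"
  define z where "z = exp (- L)"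
  define q where "q k = (LINT u:{s..t}|lborel. pmf (p u) k * lam u)" for k
  define b where "b k = z ^ Suc k * q k + (if k = 1 then z else 0)" for k
  define S where "S w = z * (L - A * defect (z * w)) + z * w" for w
  have L: "0 \<le> L" and A: "0 \<le> A" "A \<le> c * L"
    using Lam_mono[OF st] births_mono[OF st] births_increment_le[OF st] by (auto simp: L_def A_def c_def)
  have c: "0 \<le> c" using theta_range by (simp add: c_def)
  have z: "0 < z" "z \<le> 1" "1 - L \<le> z" "L > 0 \<Longrightarrow> z < 1"
    using L exp_ge_add_one_self[of "- L"] by (auto simp: z_def)
  have zL: "z - 1 + L \<le> L\<^sup>2"
  proof -
    have "z * (1 + L) \<le> z * exp L" using z by (intro mult_left_mono) auto
    also have "\<dots> = 1" by (simp add: z_def exp_minus)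
    finally have "z * (1 + L) \<le> 1" .
    moreover have "L * (1 - L) \<le> L * z" using z L by (intro mult_left_mono) auto
    ultimately show ?thesis by (simp add: algebra_simps power2_eq_square)
  qed
  have q0: "0 \<le> q k" for k
    unfolding q_def set_lebesgue_integral_def using lam_nonneg st
    by (intro Bochner_Integration.integral_nonneg) (auto split: split_indicator)
  have q1: "q 1 = 0"
    unfolding q_def offspring_mass[OF st] using theta_range by (simp add: defect_coeff_def)
  have b_le: "b k \<le> pmf (kernel s t) k" for k
    using kernel_one_ge[OF st] kernel_ge[OF st, of k] q1
    by (cases "k = 1") (auto simp: b_def q_def[symmetric] z_def L_def)
  \<comment> \<open>the series of \<open>defect\<close> is used below \<open>1\<close> only; \<open>z * w\<close> reaches \<open>1\<close> only if \<open>L = 0\<close>, and then \<open>A = 0\<close>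
    and the coefficients \<open>q k\<close> vanish\<close>
  have S: "(\<lambda>k. b k * w ^ k) sums S w" if w: "0 \<le> w" "w \<le> 1" "w < 1 \<or> L > 0 \<or> L = 0 \<and> A = 0" for w
  proof -
    have zw: "0 \<le> z * w" "z * w < 1 \<or> Lam s = Lam t \<and> births s = births t"
    proof -
      show "0 \<le> z * w" using w z by simp
      show "z * w < 1 \<or> Lam s = Lam t \<and> births s = births t"
      proof (cases "L = 0")
        case True
        hence "z = 1" by (simp add: z_def)
        with w True show ?thesis by (auto simp: L_def A_def)
      next
        case False
        hence "z < 1" using z(4) L by simp
        moreover have "z * w \<le> z * 1" using w z by (intro mult_left_mono) auto
        ultimately show ?thesis by simp
      qed
    qed
    have "(\<lambda>k. z * (q k * (z * w) ^ k)) sums (z * (L - A * defect (z * w)))"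
      unfolding q_def L_def A_def by (intro sums_mult offspring_mass_sums st zw)
    moreover have "(\<lambda>k. if k = 1 then z * w else 0) sums (z * w)"
      using sums_If_finite_set[of "{1::nat}" "\<lambda>_. z * w"] by simp
    ultimately have "(\<lambda>k. z * (q k * (z * w) ^ k) + (if k = 1 then z * w else 0)) sums S w"
      unfolding S_def by (rule sums_add)
    moreover have "z * (q k * (z * w) ^ k) + (if k = 1 then z * w else 0) = b k * w ^ k" for k
      by (auto simp: b_def algebra_simps power_mult_distrib)
    ultimately show ?thesis by simp
  qed
  have "L > 0 \<or> L = 0 \<and> A = 0" using L A by (cases "L = 0") auto
  hence S1: "b sums S 1" using S[of 1] by simp
  have Sy: "(\<lambda>k. b k * y ^ k) sums S y" using S y by simp
  have P: "(\<lambda>k. pmf (kernel s t) k * y ^ k) sums pgf (kernel s t) y" "pmf (kernel s t) sums 1"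
    using pgf_sums[of y "kernel s t"] pgf_sums[of 1 "kernel s t"] y by auto
  have low: "S y \<le> pgf (kernel s t) y"
    by (rule sums_le[OF _ Sy P(1)]) (use b_le y in \<open>auto intro: mult_right_mono\<close>)
  have "pgf (kernel s t) y - S y \<le> 1 - S 1"
  proof (rule sums_le[OF _ sums_diff[OF P(1) Sy] sums_diff[OF P(2) S1]])
    fix k
    have "(pmf (kernel s t) k - b k) * y ^ k \<le> (pmf (kernel s t) k - b k) * 1"
      using b_le y by (intro mult_left_mono) (auto simp: power_le_one)
    thus "pmf (kernel s t) k * y ^ k - b k * y ^ k \<le> pmf (kernel s t) k - b k"
      by (simp add: algebra_simps)
  qed
  also have "1 - S 1 \<le> (1 + c) * L\<^sup>2"
  proof -
    have "1 - L\<^sup>2 \<le> z * (1 + L)"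
      using mult_right_mono[OF z(3), of "1 + L"] L by (simp add: algebra_simps power2_eq_square)
    moreover have "z * (A * defect z) \<le> 1 * ((c * L) * L)"
    proof (intro mult_mono)
      show "defect z \<le> L" using defect_le[of z] z by simp
    qed (use z A c L defect_nonneg[of z] in auto)
    ultimately show ?thesis by (simp add: S_def algebra_simps power2_eq_square)
  qed
  finally have up: "pgf (kernel s t) y - S y \<le> (1 + c) * L\<^sup>2" .
  have "\<bar>(z - 1) * L\<bar> \<le> L\<^sup>2"
  proof -
    have "\<bar>z - 1\<bar> \<le> L" using z by auto
    thus ?thesis using L by (simp add: abs_mult power2_eq_square mult_right_mono)
  qed
  moreover have "\<bar>y * (z - 1 + L)\<bar> \<le> L\<^sup>2"
  proof -
    have "\<bar>y * (z - 1 + L)\<bar> = y * (z - 1 + L)" using y z by simp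
    also have "\<dots> \<le> z - 1 + L" using y z by (intro mult_left_le_one_le) auto
    finally show ?thesis using zL by simp
  qed
  moreover have "\<bar>A * (defect y - z * defect (z * y))\<bar> \<le> c * L\<^sup>2"
  proof -
    have zy: "0 \<le> z * y" "z * y \<le> y" using y z by (auto intro: mult_left_le_one_le)
    have "y - z * y \<le> L"
    proof -
      have "y - z * y = y * (1 - z)" by (simp add: algebra_simps)
      also have "\<dots> \<le> 1 - z" using y z by (intro mult_left_le_one_le) auto
      finally show ?thesis using z by simp
    qed
    moreover have "(1 - z) * defect (z * y) \<le> L"
    proof -
      have "defect (z * y) \<le> 1"
        using zy y defect_le[of "z * y"] by linarith
      hence "(1 - z) * defect (z * y) \<le> (1 - z) * 1"
        using z by (intro mult_left_mono) auto
      thus ?thesis using z by simp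
    qed
    moreover have "0 \<le> (1 - z) * defect (z * y)"
      using z zy y defect_nonneg[of "z * y"] by simp
    moreover have "defect y - z * defect (z * y) = (1 - z) * defect (z * y) - (defect (z * y) - defect y)"
      by (simp add: algebra_simps)
    ultimately have "\<bar>defect y - z * defect (z * y)\<bar> \<le> L"
      using defect_Lipschitz[OF zy y(2)] by linarith
    hence "A * \<bar>defect y - z * defect (z * y)\<bar> \<le> (c * L) * L"
      using A L c by (intro mult_mono) auto
    thus ?thesis using A by (simp add: abs_mult power2_eq_square)
  qed
  moreover have "S y - (y + L * (1 - y) - A * defect y) = (z - 1) * L + y * (z - 1 + L) + A * (defect y - z * defect (z * y))"
    by (simp add: S_def algebra_simps)
  ultimately have "\<bar>S y - (y + L * (1 - y) - A * defect y)\<bar> \<le> L\<^sup>2 + L\<^sup>2 + c * L\<^sup>2"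
    by linarith
  with low up have "\<bar>pgf (kernel s t) y - (y + L * (1 - y) - A * defect y)\<bar> \<le> (1 + c) * L\<^sup>2 + (L\<^sup>2 + L\<^sup>2 + c * L\<^sup>2)"
    by linarith
  also have "\<dots> = (5 + 2 / \<theta>) * L\<^sup>2"
    by (simp add: c_def algebra_simps)
  finally show ?thesis .
qed

lemma kernel_pgf_compose:
  assumes "0 \<le> s" "s \<le> r" "r \<le> t" "0 \<le> x" "x \<le> 1"
  shows "pgf (kernel s t) x = pgf (kernel s r) (pgf (kernel r t) x)"
  using assms by (simp add: chapman_kolmogorov[of s r t] pgf_bind_iid_sum)

lemma kernel_refl:
  assumes "0 \<le> t"
  shows "kernel t t = return_pmf 1"
proof -
  have "1 \<le> pmf (kernel t t) 1" using kernel_one_ge[of t t] assms by simp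
  hence "measure (measure_pmf (kernel t t)) {1} = 1"
    using pmf_le_1[of "kernel t t" 1] by (simp add: measure_pmf_single)
  hence "AE n in measure_pmf (kernel t t). n \<in> {1}"
    by (subst (asm) measure_pmf.prob_eq_1) auto
  thus ?thesis
    unfolding AE_measure_pmf_iff set_pmf_subset_singleton[symmetric] by auto
qed

text \<open>
  Keeps \<open>1 - pgf\<close> away from \<open>0\<close> on compact time intervals, where the power with exponent
  \<open>- \<theta>\<close> is smooth: the single individual that does not die contributes \<open>1 - x\<close>.
\<close>

lemma kernel_pgf_gap:
  assumes "0 \<le> s" "s \<le> t" "0 \<le> x" "x \<le> 1"
  shows "exp (- (Lam t - Lam s)) * (1 - x) \<le> 1 - pgf (kernel s t) x"
proof -
  have "(\<lambda>k. pmf (kernel s t) k * 1 ^ k - pmf (kernel s t) k * x ^ k) sums (1 - pgf (kernel s t) x)"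
    using pgf_sums[of 1 "kernel s t"] pgf_sums[of x "kernel s t"] assms by (intro sums_diff) auto
  hence "(\<Sum>k\<in>{1}. pmf (kernel s t) k * 1 ^ k - pmf (kernel s t) k * x ^ k) \<le> 1 - pgf (kernel s t) x"
    by (rule sums_le[OF _ sums_If_finite_set[OF finite.insertI[OF finite.emptyI]], rotated]) (use assms in \<open>auto simp: power_le_one intro!: mult_left_le\<close>)
  moreover have "exp (- (Lam t - Lam s)) * (1 - x) \<le> pmf (kernel s t) 1 * (1 - x)"
    using assms by (intro mult_right_mono kernel_one_ge) auto
  ultimately show ?thesis by (simp add: algebra_simps)
qed

end

section \<open>One step of the linearised Bernoulli equation\<close>

lemma powr_Taylor2:
  fixes \<theta> w0 v w :: real
  assumes "0 < \<theta>" "0 < w0" "w0 \<le> v" "v \<le> 1" "w0 \<le> w" "w \<le> 1"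
  shows "\<bar>w powr - \<theta> - v powr - \<theta> + \<theta> * v powr (- \<theta> - 1) * (w - v)\<bar>
    \<le> \<theta> * (\<theta> + 1) * w0 powr (- \<theta> - 2) * (w - v)\<^sup>2"
proof (cases "w = v")
  case False
  define diff :: "nat \<Rightarrow> real \<Rightarrow> real" where
    "diff m = (if m = 0 then (\<lambda>x. x powr - \<theta>) else if m = 1 then (\<lambda>x. - \<theta> * x powr (- \<theta> - 1))
       else (\<lambda>x. \<theta> * (\<theta> + 1) * x powr (- \<theta> - 2)))" for m
  have "\<exists>t. (if w < v then w < t \<and> t < v else v < t \<and> t < w) \<and>
     w powr - \<theta> = (\<Sum>m<2. diff m v / fact m * (w - v) ^ m) + diff 2 t / fact 2 * (w - v) ^ 2"
  proof (rule Taylor[where a=w0 and b=1])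
    show "\<forall>m t. m < 2 \<and> w0 \<le> t \<and> t \<le> 1 \<longrightarrow> DERIV (diff m) t :> diff (Suc m) t"
    proof (intro allI impI)
      fix m :: nat and t assume mt: "m < 2 \<and> w0 \<le> t \<and> t \<le> 1"
      hence t: "0 < t" using assms by auto
      consider "m = 0" | "m = 1" using mt by linarith
      thus "DERIV (diff m) t :> diff (Suc m) t"
      proof cases
        case 1
        show ?thesis unfolding 1 diff_def using t
          by (auto intro!: derivative_eq_intros)
      next
        case 2
        have "DERIV (\<lambda>x. - \<theta> * x powr (- \<theta> - 1)) t :> - \<theta> * ((- \<theta> - 1) * t powr (- \<theta> - 1 - 1))"
          by (intro DERIV_cmult has_real_derivative_powr t)
        moreover have "- \<theta> * ((- \<theta> - 1) * t powr (- \<theta> - 1 - 1)) = \<theta> * (\<theta> + 1) * t powr (- \<theta> - 2)"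
          by (simp add: algebra_simps)
        ultimately show ?thesis unfolding 2 diff_def by simp
      qed
    qed
  qed (use assms False in \<open>auto simp: diff_def\<close>)
  then obtain t where t: "if w < v then w < t \<and> t < v else v < t \<and> t < w"
    and eq: "w powr - \<theta> = (\<Sum>m<2. diff m v / fact m * (w - v) ^ m) + diff 2 t / fact 2 * (w - v) ^ 2"
    by blast
  have t0: "w0 \<le> t" using t assms by (auto split: if_splits)
  have "w powr - \<theta> - v powr - \<theta> + \<theta> * v powr (- \<theta> - 1) * (w - v) =
     \<theta> * (\<theta> + 1) * t powr (- \<theta> - 2) / 2 * (w - v)\<^sup>2"
    using eq by (simp add: diff_def numeral_2_eq_2)
  moreover have "\<bar>\<theta> * (\<theta> + 1) * t powr (- \<theta> - 2) / 2 * (w - v)\<^sup>2\<bar> \<le>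
     \<theta> * (\<theta> + 1) * w0 powr (- \<theta> - 2) * (w - v)\<^sup>2"
  proof -
    have "t powr (- \<theta> - 2) / 2 \<le> w0 powr (- \<theta> - 2)"
      using powr_mono2'[of "- \<theta> - 2" w0 t] assms t0 powr_ge_zero[of t "- \<theta> - 2"] by linarith
    hence "\<theta> * (\<theta> + 1) * (t powr (- \<theta> - 2) / 2) \<le> \<theta> * (\<theta> + 1) * w0 powr (- \<theta> - 2)"
      using assms by (intro mult_left_mono) auto
    from mult_right_mono[OF this, of "(w - v)\<^sup>2"] show ?thesis
      using assms by (simp add: abs_mult)
  qed
  ultimately show ?thesis by simp
qed simp

lemma exp_Taylor_bounds:
  fixes x B :: real
  assumes "\<bar>x\<bar> \<le> B"
  shows "\<bar>exp x - 1\<bar> \<le> exp B * \<bar>x\<bar>" and "\<bar>exp x - 1 - x\<bar> \<le> exp B * x\<^sup>2"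
proof -
  have "\<bar>exp x - 1\<bar> \<le> exp \<bar>x\<bar> * \<bar>x\<bar>"
    using Taylor_exp_field[of x 0] by simp
  also have "\<dots> \<le> exp B * \<bar>x\<bar>"
    using assms by (intro mult_right_mono) auto
  finally show "\<bar>exp x - 1\<bar> \<le> exp B * \<bar>x\<bar>" .
  have "\<bar>exp x - 1 - x\<bar> \<le> exp \<bar>x\<bar> * x\<^sup>2"
    using Taylor_exp_field[of x 1] by (simp add: numeral_2_eq_2 algebra_simps)
  also have "\<dots> \<le> exp B * x\<^sup>2"
    using assms by (intro mult_right_mono) auto
  finally show "\<bar>exp x - 1 - x\<bar> \<le> exp B * x\<^sup>2" .
qed

text \<open>
  If \<open>w\<close> arises from \<open>v\<close> by one Euler step of the Bernoulli equation, then \<open>w powr - \<theta>\<close> arises from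
  \<open>v powr - \<theta>\<close> by one Euler step of a linear equation: the first-order change
  from \<open>v powr - \<theta>\<close> to \<open>w powr - \<theta>\<close> is \<open>\<theta> * b * v powr - \<theta> + \<theta> * A / (1 + \<theta>)\<close> with \<open>b = L - A\<close>. The exponential prefactor is the
  integrating factor, and it cancels the part proportional to \<open>v powr - \<theta>\<close>. Subtracting the
  constant \<open>1 / (1 + \<theta>)\<close> makes the remaining drift independent of \<open>A\<close>. All remainders are of second
  order, uniformly as long as \<open>v\<close> and \<open>w\<close> stay above \<open>w0\<close>.
\<close>

lemma bernoulli_step:
  fixes \<theta> w0 c Lm C0 :: real
  assumes \<theta>: "0 < \<theta>" "\<theta> \<le> 1" and w0: "0 < w0" and "0 \<le> c" "0 \<le> C0" "0 \<le> Lm"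
  obtains C where "\<And>w v L A. w0 \<le> w \<Longrightarrow> w \<le> 1 \<Longrightarrow> w0 \<le> v \<Longrightarrow> v \<le> 1 \<Longrightarrow> 0 \<le> L \<Longrightarrow> L \<le> Lm \<Longrightarrow>
    0 \<le> A \<Longrightarrow> A \<le> c * L \<Longrightarrow>
    \<bar>w - (v - (L - A) * v - A * v powr (1 + \<theta>) / (1 + \<theta>))\<bar> \<le> C0 * L\<^sup>2 \<Longrightarrow>
    \<bar>exp (- (\<theta> * (L - A))) * (w powr - \<theta> - 1 / (1 + \<theta>)) - (v powr - \<theta> - 1 / (1 + \<theta>)) - \<theta> / (1 + \<theta>) * L\<bar> \<le> C * L\<^sup>2"
proof -
  define \<kappa> where "\<kappa> = 1 / (1 + \<theta>)"
  define d where "d = 1 + c"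
  define \<rho> where "\<rho> = C0 * Lm + d + c"
  define Q where "Q = w0 powr - \<theta>"
  define Q1 where "Q1 = w0 powr (- \<theta> - 1)"
  define Q2 where "Q2 = \<theta> * (\<theta> + 1) * w0 powr (- \<theta> - 2)"
  define CU where "CU = Q2 * \<rho>\<^sup>2 + Q1 * C0"
  define C where "C = exp (d * Lm) * d\<^sup>2 * (Q + 1) + (1 + d * Lm) * CU + d\<^sup>2 * Q + d * c"
  have \<kappa>: "0 \<le> \<kappa>" "\<kappa> \<le> 1" using \<theta> by (auto simp: \<kappa>_def)
  have d: "0 \<le> d" "c \<le> d" "1 \<le> d" using assms by (auto simp: d_def)
  have pos: "0 \<le> Q" "0 \<le> Q1" "0 \<le> Q2" "0 \<le> \<rho>" "0 \<le> CU"
    using assms d by (auto simp: Q_def Q1_def Q2_def \<rho>_def CU_def intro!: add_nonneg_nonneg mult_nonneg_nonneg)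
  show thesis
  proof (rule that[of C])
    fix w v L A :: real
    assume w: "w0 \<le> w" "w \<le> 1" and v: "w0 \<le> v" "v \<le> 1" and L: "0 \<le> L" "L \<le> Lm"
      and A: "0 \<le> A" "A \<le> c * L"
      and err: "\<bar>w - (v - (L - A) * v - A * v powr (1 + \<theta>) / (1 + \<theta>))\<bar> \<le> C0 * L\<^sup>2"
    define b where "b = L - A"
    \<comment> \<open>\<open>E1\<close>, \<open>T\<close> and \<open>X\<close> are the second-order remainders of the Euler step, of the power and of the
      exponential; \<open>U\<close> collects the first two\<close>
    define E1 where "E1 = w - (v - b * v - A * \<kappa> * v powr (1 + \<theta>))"
    define P where "P = v powr - \<theta>"
    define R where "R = v powr (- \<theta> - 1)"
    define T where "T = w powr - \<theta> - P + \<theta> * R * (w - v)"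
    define U where "U = T - \<theta> * R * E1"
    define X where "X = exp (- (\<theta> * b)) - 1 + \<theta> * b"
    have vw: "0 < v" "0 < w" using w0 v w by auto
    have b: "\<bar>b\<bar> \<le> d * L"
    proof -
      have "c * L \<ge> 0" using assms L by simp
      thus ?thesis using A L unfolding b_def d_def by (auto simp: algebra_simps)
    qed
    have b2: "b\<^sup>2 \<le> d\<^sup>2 * L\<^sup>2"
      using power_mono[OF b, of 2] by (simp add: power_mult_distrib)
    have bLm: "\<bar>b\<bar> \<le> d * Lm"
      using b mult_left_mono[OF L(2) d(1)] by linarith
    have \<theta>b: "\<bar>\<theta> * b\<bar> \<le> \<bar>b\<bar>"
      using \<theta> by (simp add: abs_mult mult_left_le_one_le)
    have vp: "0 \<le> v powr (1 + \<theta>)" "v powr (1 + \<theta>) \<le> 1"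
      using vw v \<theta> by (auto intro: powr_le1)
    have E1: "\<bar>E1\<bar> \<le> C0 * L\<^sup>2"
      using err by (simp add: E1_def b_def \<kappa>_def)
    have P: "0 \<le> P" "P \<le> Q" and R: "0 \<le> R" "R \<le> Q1" and W: "0 \<le> w powr - \<theta>" "w powr - \<theta> \<le> Q"
      using \<theta> w0 v w unfolding P_def R_def Q_def Q1_def by (auto intro!: powr_mono2')
    have r: "\<bar>w - v\<bar> \<le> \<rho> * L"
    proof -
      have "w - v = E1 - b * v - A * (\<kappa> * v powr (1 + \<theta>))"
        by (simp add: E1_def)
      moreover have "\<bar>b * v\<bar> \<le> d * L"
        using b vw v mult_right_le_one_le[of "\<bar>b\<bar>" v] by (simp add: abs_mult)
      moreover have "\<bar>A * (\<kappa> * v powr (1 + \<theta>))\<bar> \<le> c * L"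
      proof -
        have "\<kappa> * v powr (1 + \<theta>) \<le> 1" "0 \<le> \<kappa> * v powr (1 + \<theta>)"
          using \<kappa> vp by (auto intro: mult_le_one)
        hence "A * (\<kappa> * v powr (1 + \<theta>)) \<le> A" "0 \<le> A * (\<kappa> * v powr (1 + \<theta>))"
          using A by (auto intro: mult_right_le_one_le)
        thus ?thesis using A by linarith
      qed
      moreover have "C0 * L\<^sup>2 \<le> C0 * Lm * L"
        using L \<open>0 \<le> C0\<close> by (simp add: power2_eq_square mult.assoc mult_left_mono mult_right_mono)
      ultimately have "\<bar>w - v\<bar> \<le> C0 * Lm * L + d * L + c * L"
        using E1 by linarith
      thus ?thesis by (simp add: \<rho>_def algebra_simps)
    qed
    have "\<bar>T\<bar> \<le> Q2 * (w - v)\<^sup>2"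
      unfolding T_def P_def R_def Q2_def by (rule powr_Taylor2) (use \<theta> w0 v w in auto)
    also have "(w - v)\<^sup>2 \<le> (\<rho> * L)\<^sup>2"
      using power_mono[OF r, of 2] by simp
    finally have T: "\<bar>T\<bar> \<le> Q2 * \<rho>\<^sup>2 * L\<^sup>2"
      using pos by (simp add: power_mult_distrib mult_left_mono mult.assoc)
    have "\<bar>\<theta> * R * E1\<bar> \<le> Q1 * (C0 * L\<^sup>2)"
      unfolding abs_mult using \<theta> R E1 pos
      by (intro mult_mono) (auto intro: order_trans[OF mult_left_le_one_le])
    with T have U: "\<bar>U\<bar> \<le> CU * L\<^sup>2"
      unfolding U_def CU_def by (simp add: algebra_simps)
    have "\<bar>X\<bar> \<le> exp (d * Lm) * (\<theta> * b)\<^sup>2"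
      using exp_Taylor_bounds(2)[of "- (\<theta> * b)" "d * Lm"] \<theta>b bLm by (simp add: X_def)
    also have "(\<theta> * b)\<^sup>2 \<le> b\<^sup>2"
      using power_mono[OF \<theta>b, of 2] by simp
    finally have X: "\<bar>X\<bar> \<le> exp (d * Lm) * (d\<^sup>2 * L\<^sup>2)"
      using b2 by (meson exp_ge_zero mult_left_mono order_trans)
    \<comment> \<open>all terms of order zero and one cancel, because \<open>\<theta> * \<kappa> * A + \<theta> * \<kappa> * b = \<theta> * \<kappa> * L\<close>\<close>
    have main: "exp (- (\<theta> * b)) * (w powr - \<theta> - \<kappa>) - (P - \<kappa>) - \<theta> * \<kappa> * L =
      X * (w powr - \<theta> - \<kappa>) + (1 - \<theta> * b) * U - (\<theta> * b)\<^sup>2 * P - \<theta> * b * (\<theta> * \<kappa> * A)"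
    proof -
      have RP: "R * v = P" "R * v powr (1 + \<theta>) = 1"
      proof -
        have "R * v = v powr (- \<theta> - 1) * v powr 1" using vw by (simp add: R_def)
        also have "\<dots> = P" unfolding powr_add[symmetric] by (simp add: P_def)
        finally show "R * v = P" .
        show "R * v powr (1 + \<theta>) = 1"
          unfolding R_def powr_add[symmetric] using vw by simp
      qed
      have "\<theta> * R * (w - v) = \<theta> * R * E1 - \<theta> * b * (R * v) - \<theta> * \<kappa> * A * (R * v powr (1 + \<theta>))"
        by (simp add: E1_def algebra_simps)
      hence W': "w powr - \<theta> = P + \<theta> * b * P + \<theta> * \<kappa> * A + U"
        unfolding RP by (simp add: U_def T_def)
      have ex: "exp (- (\<theta> * b)) = X + (1 - \<theta> * b)" by (simp add: X_def)
      have "exp (- (\<theta> * b)) * (w powr - \<theta> - \<kappa>) = X * (w powr - \<theta> - \<kappa>) + (1 - \<theta> * b) * (P + \<theta> * b * P + \<theta> * \<kappa> * A + U - \<kappa>)"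
        unfolding ex distrib_right by (simp add: W')
      moreover have "(1 - \<theta> * b) * (P + \<theta> * b * P + \<theta> * \<kappa> * A + U - \<kappa>) =
        (1 - \<theta> * b) * U + P - (\<theta> * b)\<^sup>2 * P + \<theta> * \<kappa> * A - \<theta> * b * (\<theta> * \<kappa> * A) - \<kappa> + \<theta> * \<kappa> * b"
        by (simp add: algebra_simps power2_eq_square)
      moreover have "\<theta> * \<kappa> * b = \<theta> * \<kappa> * L - \<theta> * \<kappa> * A"
        by (simp add: b_def algebra_simps)
      ultimately show ?thesis by linarith
    qed
    have "\<bar>X * (w powr - \<theta> - \<kappa>)\<bar> \<le> exp (d * Lm) * (d\<^sup>2 * L\<^sup>2) * (Q + 1)"
    proof -
      have "\<bar>w powr - \<theta> - \<kappa>\<bar> \<le> Q + 1" using W \<kappa> by linarith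
      thus ?thesis unfolding abs_mult using X by (intro mult_mono) auto
    qed
    moreover have "\<bar>(1 - \<theta> * b) * U\<bar> \<le> (1 + d * Lm) * (CU * L\<^sup>2)"
      unfolding abs_mult using U \<theta>b bLm d L assms(6) by (intro mult_mono) auto
    moreover have "\<bar>(\<theta> * b)\<^sup>2 * P\<bar> \<le> (d\<^sup>2 * L\<^sup>2) * Q"
      unfolding abs_mult using P pos power_mono[OF \<theta>b, of 2] b2 by (intro mult_mono) auto
    moreover have "\<bar>\<theta> * b * (\<theta> * \<kappa> * A)\<bar> \<le> (d * L) * (c * L)"
    proof -
      have "\<bar>\<theta> * \<kappa> * A\<bar> \<le> 1 * A"
        unfolding abs_mult using \<theta> \<kappa> A by (intro mult_mono mult_le_one) auto
      thus ?thesis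
        unfolding abs_mult[of "\<theta> * b"] using \<theta>b b A d L by (intro mult_mono) auto
    qed
    ultimately have "\<bar>exp (- (\<theta> * b)) * (w powr - \<theta> - \<kappa>) - (P - \<kappa>) - \<theta> * \<kappa> * L\<bar> \<le>
       exp (d * Lm) * (d\<^sup>2 * L\<^sup>2) * (Q + 1) + (1 + d * Lm) * (CU * L\<^sup>2) + (d\<^sup>2 * L\<^sup>2) * Q + (d * L) * (c * L)"
      unfolding main by linarith
    also have "\<dots> = C * L\<^sup>2"
      by (simp add: C_def algebra_simps power2_eq_square)
    finally show "\<bar>exp (- (\<theta> * (L - A))) * (w powr - \<theta> - 1 / (1 + \<theta>)) - (v powr - \<theta> - 1 / (1 + \<theta>)) - \<theta> / (1 + \<theta>) * L\<bar> \<le> C * L\<^sup>2"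
      by (simp add: b_def P_def \<kappa>_def)
  qed
qed

section \<open>The explicit generating function\<close>

context theta_environment
begin

lemma growth_powr: "growth t powr (- \<theta>) = exp (- (\<theta> * (births t - Lam t)))"
  by (simp add: growth_def powr_def)

lemma growth_powr_le:
  assumes "0 \<le> s" "s \<le> t"
  shows "growth s powr (- \<theta>) \<le> exp (Lam t)"
proof -
  have "\<theta> * Lam s \<le> Lam s" "0 \<le> \<theta> * births s"
    using theta_range Lam_mono[of 0 s] births_mono[of 0 s] assms by (auto intro: mult_left_le_one_le)
  thus ?thesis using Lam_mono[OF assms] unfolding growth_powr by (simp add: algebra_simps)
qed

lemma abs_births_Lam_le:
  assumes "0 \<le> s" "s \<le> t"
  shows "\<bar>(births t - births s) - (Lam t - Lam s)\<bar> \<le> (2 + 1 / \<theta>) * (Lam t - Lam s)"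
  using births_mono[OF assms] births_increment_le[OF assms] Lam_mono[OF assms]
  by (simp add: algebra_simps)

text \<open>
  On a short interval the weight in \<open>Vint\<close> may be frozen at the right end point, since it varies by
  at most a multiple of the increment of \<open>Lam\<close>.
\<close>

lemma Vint_increment_approx:
  assumes "0 \<le> s" "s \<le> r" "r \<le> t"
  defines "d \<equiv> 2 + 1 / \<theta>"
  shows "\<bar>Vint r - Vint s - \<theta> / (1 + \<theta>) * growth r powr (- \<theta>) * (Lam r - Lam s)\<bar> \<le>
     exp (Lam t) * exp (d * Lam t) * d * (Lam r - Lam s)\<^sup>2"
proof -
  define L where "L = Lam r - Lam s"
  define D where "D = exp (Lam t) * (exp (d * Lam t) * (d * L))"
  have d: "0 \<le> d" using theta_range by (simp add: d_def)
  have L: "0 \<le> L" "L \<le> Lam t"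
    using Lam_mono[of s r] Lam_mono[of r t] Lam_mono[of 0 s] assms by (auto simp: L_def)
  have D: "0 \<le> D" using d L by (simp add: D_def)
  have diff: "\<bar>growth u powr (- \<theta>) - growth r powr (- \<theta>)\<bar> \<le> D" if u: "u \<in> {s..r}" for u
  proof -
    define b where "b = \<theta> * ((births r - births u) - (Lam r - Lam u))"
    have "\<bar>b\<bar> \<le> \<bar>(births r - births u) - (Lam r - Lam u)\<bar>"
      using theta_range by (simp add: b_def abs_mult mult_left_le_one_le)
    also have "\<dots> \<le> d * (Lam r - Lam u)"
      using abs_births_Lam_le[of u r] u assms by (simp add: d_def)
    also have "\<dots> \<le> d * L"
      using d Lam_mono[of s u] u assms by (intro mult_left_mono) (auto simp: L_def)
    finally have b: "\<bar>b\<bar> \<le> d * L" .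
    have "d * L \<le> d * Lam t" using d L by (intro mult_left_mono)
    with b have b': "\<bar>b\<bar> \<le> d * Lam t" by linarith
    have "growth u powr (- \<theta>) = growth r powr (- \<theta>) * exp b"
      unfolding growth_powr exp_add[symmetric] b_def by (simp add: algebra_simps)
    hence "growth u powr (- \<theta>) - growth r powr (- \<theta>) = growth r powr (- \<theta>) * (exp b - 1)"
      by (simp add: algebra_simps)
    hence "\<bar>growth u powr (- \<theta>) - growth r powr (- \<theta>)\<bar> = growth r powr (- \<theta>) * \<bar>exp b - 1\<bar>"
      by (simp add: abs_mult)
    also have "\<dots> \<le> exp (Lam t) * (exp (d * Lam t) * (d * L))"
    proof (intro mult_mono)
      have "\<bar>exp b - 1\<bar> \<le> exp (d * Lam t) * \<bar>b\<bar>" by (rule exp_Taylor_bounds(1)[OF b'])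
      also have "\<dots> \<le> exp (d * Lam t) * (d * L)" using b by (intro mult_left_mono) auto
      finally show "\<bar>exp b - 1\<bar> \<le> exp (d * Lam t) * (d * L)" .
    qed (use growth_powr_le[of r t] assms in auto)
    finally show ?thesis by (simp add: D_def)
  qed
  have int: "set_integrable lborel {s..r} (\<lambda>u. growth u powr (- \<theta>) * lam u)"
    using growth_weight_integrable[of r] assms by (auto intro: set_integrable_subset)
  have lamint: "set_integrable lborel {s..r} (\<lambda>u. x * lam u)" for x :: real
    using lam_set_integrable[of s r] assms by auto
  have scale: "(LINT u:{s..r}|lborel. x * lam u) = x * L" for x :: real
    unfolding set_integral_mult_right using assms by (simp add: Lam_increment L_def)
  have "(LINT u:{s..r}|lborel. growth u powr (- \<theta>) * lam u) \<le> (LINT u:{s..r}|lborel. (growth r powr (- \<theta>) + D) * lam u)"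
  proof (intro set_integral_mono int lamint mult_right_mono)
    show "growth u powr (- \<theta>) \<le> growth r powr (- \<theta>) + D" if "u \<in> {s..r}" for u
      using diff[OF that] by linarith
  qed (use lam_nonneg assms in auto)
  hence up: "(LINT u:{s..r}|lborel. growth u powr (- \<theta>) * lam u) - growth r powr (- \<theta>) * L \<le> D * L"
    unfolding scale by (simp add: algebra_simps)
  have "(LINT u:{s..r}|lborel. (growth r powr (- \<theta>) - D) * lam u) \<le> (LINT u:{s..r}|lborel. growth u powr (- \<theta>) * lam u)"
  proof (intro set_integral_mono int lamint mult_right_mono)
    show "growth r powr (- \<theta>) - D \<le> growth u powr (- \<theta>)" if "u \<in> {s..r}" for u
      using diff[OF that] by linarith
  qed (use lam_nonneg assms in auto)
  hence "growth r powr (- \<theta>) * L - (LINT u:{s..r}|lborel. growth u powr (- \<theta>) * lam u) \<le> D * L"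
    unfolding scale by (simp add: algebra_simps)
  with up have *: "\<bar>(LINT u:{s..r}|lborel. growth u powr (- \<theta>) * lam u) - growth r powr (- \<theta>) * L\<bar> \<le> D * L"
    by linarith
  have "Vint r - Vint s - \<theta> / (1 + \<theta>) * growth r powr (- \<theta>) * L =
     \<theta> / (1 + \<theta>) * ((LINT u:{s..r}|lborel. growth u powr (- \<theta>) * lam u) - growth r powr (- \<theta>) * L)"
    using Vint_increment[of s r] assms by (simp only: right_diff_distrib mult.assoc)
  hence "\<bar>Vint r - Vint s - \<theta> / (1 + \<theta>) * growth r powr (- \<theta>) * L\<bar> =
     \<theta> / (1 + \<theta>) * \<bar>(LINT u:{s..r}|lborel. growth u powr (- \<theta>) * lam u) - growth r powr (- \<theta>) * L\<bar>"
    using theta_range by (simp only: abs_mult) simp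
  also have "\<dots> \<le> 1 * (D * L)"
    using * theta_range by (intro mult_mono) auto
  finally show ?thesis by (simp add: D_def L_def power2_eq_square algebra_simps)
qed

end

context theta_positive_bpve
begin

text \<open>
  The quantity \<open>g s\<close> below is the first integral of the backward equation. Its increments are of
  second order in those of \<open>Lam\<close>, by the expansion of the kernel and the Bernoulli step, so it is
  constant. Comparing its values at \<open>0\<close> and \<open>t\<close> gives the formula.
\<close>

lemma explicit_pgf_formula:
  assumes "0 \<le> t" "0 \<le> x" "x < 1"
  shows "(1 - pgf (kernel 0 t) x) powr (- \<theta>) =
    growth t powr (- \<theta>) * ((1 - x) powr (- \<theta>) - 1 / (1 + \<theta>)) + Vint t + 1 / (1 + \<theta>)"
proof -
  define w where "w s = 1 - pgf (kernel s t) x" for s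
  define g where "g s = growth s powr (- \<theta>) * (w s powr (- \<theta>) - 1 / (1 + \<theta>)) + Vint s" for s
  define w0 where "w0 = exp (- Lam t) * (1 - x)"
  define d where "d = 2 + 1 / \<theta>"
  have w0: "0 < w0" using assms by (simp add: w0_def)
  have w: "w0 \<le> w s" "w s \<le> 1" if "0 \<le> s" "s \<le> t" for s
  proof -
    have "w0 \<le> exp (- (Lam t - Lam s)) * (1 - x)"
      unfolding w0_def using Lam_mono[of 0 s] that assms by (intro mult_right_mono) auto
    thus "w0 \<le> w s" using kernel_pgf_gap[of s t x] that assms by (simp add: w_def)
    show "w s \<le> 1" using pgf_nonneg[of x] assms by (simp add: w_def)
  qed
  obtain C where C: "\<And>w v L A. w0 \<le> w \<Longrightarrow> w \<le> 1 \<Longrightarrow> w0 \<le> v \<Longrightarrow> v \<le> 1 \<Longrightarrow> 0 \<le> L \<Longrightarrow> L \<le> Lam t \<Longrightarrow>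
    0 \<le> A \<Longrightarrow> A \<le> (1 + 1 / \<theta>) * L \<Longrightarrow>
    \<bar>w - (v - (L - A) * v - A * v powr (1 + \<theta>) / (1 + \<theta>))\<bar> \<le> (5 + 2 / \<theta>) * L\<^sup>2 \<Longrightarrow>
    \<bar>exp (- (\<theta> * (L - A))) * (w powr - \<theta> - 1 / (1 + \<theta>)) - (v powr - \<theta> - 1 / (1 + \<theta>)) - \<theta> / (1 + \<theta>) * L\<bar> \<le> C * L\<^sup>2"
    by (rule bernoulli_step[of \<theta> w0 "1 + 1/\<theta>" "5 + 2/\<theta>" "Lam t"])
       (use theta_range w0 Lam_mono[of 0 t] assms in auto)
  have "g t = g 0"
  proof (rule constant_if_quadratic_increments[OF continuous_on_Lam assms(1)])
    fix s r assume sr: "0 \<le> s" "s \<le> r" "r \<le> t"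
    define L where "L = Lam r - Lam s"
    define A where "A = births r - births s"
    define G where "G = growth r powr (- \<theta>)"
    have L: "0 \<le> L" "L \<le> Lam t"
      using Lam_mono[of s r] Lam_mono[of r t] Lam_mono[of 0 s] sr by (auto simp: L_def)
    have A: "0 \<le> A" "A \<le> (1 + 1 / \<theta>) * L"
      using births_mono[of s r] births_increment_le[of s r] sr by (auto simp: L_def A_def)
    have G: "0 \<le> G" "G \<le> exp (Lam t)"
      using growth_powr_le[of r t] sr by (auto simp: G_def)
    have y: "0 \<le> 1 - w r" "1 - w r < 1"
      using w[of r] w0 sr by auto
    have ws: "w s = 1 - pgf (kernel s r) (1 - w r)"
      using kernel_pgf_compose[of s r t x] sr assms by (simp add: w_def)
    have "\<bar>w s - (w r - (L - A) * w r - A * w r powr (1 + \<theta>) / (1 + \<theta>))\<bar> =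
       \<bar>pgf (kernel s r) (1 - w r) - ((1 - w r) + L * (1 - (1 - w r)) - A * defect (1 - w r))\<bar>"
      unfolding ws defect_def by (subst abs_minus_commute) (simp add: algebra_simps)
    also have "\<dots> \<le> (5 + 2 / \<theta>) * L\<^sup>2"
      unfolding L_def A_def using kernel_expansion[OF _ _ y] sr by simp
    finally have step: "\<bar>exp (- (\<theta> * (L - A))) * (w s powr - \<theta> - 1 / (1 + \<theta>)) - (w r powr - \<theta> - 1 / (1 + \<theta>)) - \<theta> / (1 + \<theta>) * L\<bar> \<le> C * L\<^sup>2"
      (is "\<bar>?e\<bar> \<le> _")
      by (intro C w L A) (use sr in auto)
    have Vs: "\<bar>Vint r - Vint s - \<theta> / (1 + \<theta>) * G * L\<bar> \<le> exp (Lam t) * exp (d * Lam t) * d * L\<^sup>2"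
      unfolding L_def G_def d_def by (rule Vint_increment_approx[OF sr])
    have "growth s powr (- \<theta>) = G * exp (- (\<theta> * (L - A)))"
      unfolding G_def growth_powr exp_add[symmetric] L_def A_def by (simp add: algebra_simps)
    hence "g r - g s = (Vint r - Vint s - \<theta> / (1 + \<theta>) * G * L) - G * ?e"
      unfolding g_def G_def[symmetric] by (simp add: algebra_simps)
    moreover have "\<bar>G * ?e\<bar> \<le> exp (Lam t) * (C * L\<^sup>2)"
      unfolding abs_mult using G step by (intro mult_mono) auto
    ultimately have "\<bar>g r - g s\<bar> \<le> exp (Lam t) * exp (d * Lam t) * d * L\<^sup>2 + exp (Lam t) * (C * L\<^sup>2)"
      using order_trans[OF abs_triangle_ineq4 add_mono[OF Vs]] by simp
    thus "\<bar>g r - g s\<bar> \<le> (exp (Lam t) * exp (d * Lam t) * d + exp (Lam t) * C) * (Lam r - Lam s)\<^sup>2"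
      by (simp add: L_def algebra_simps)
  qed
  moreover have "w t = 1 - x"
    unfolding w_def kernel_refl[OF assms(1)] by (simp add: pgf_def)
  ultimately show ?thesis by (simp add: g_def w_def)
qed

end

section \<open>Survival probability, mean and conditional law\<close>

context theta_positive_bpve
begin

text \<open>
  With \<open>growth t\<close> factored out of the formula for the generating function, everything that depends
  on time is this single quantity; it differs from \<open>\<mu>\<^sub>t\<^sup>\<theta> V\<^sub>t\<close> by a term that vanishes together with
  \<open>growth\<close>.
\<close>

definition V_scaled :: "real \<Rightarrow> real" where
  "V_scaled t = growth t powr \<theta> * Vint t + growth t powr \<theta> / (1 + \<theta>)"

lemma V_scaled_pos: "0 \<le> t \<Longrightarrow> 0 < V_scaled t"
  unfolding V_scaled_def using theta_range Vint_nonneg[of t] growth_pos[of t]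
  by (intro add_nonneg_pos) (auto intro!: mult_nonneg_nonneg divide_pos_pos simp: less_imp_neq[symmetric])

lemma powr_minus_kappa:
  assumes "0 \<le> x" "x < 1"
  shows "\<theta> / (1 + \<theta>) \<le> (1 - x) powr (- \<theta>) - 1 / (1 + \<theta>)"
proof -
  have "1 \<le> (1 - x) powr (- \<theta>)"
    using powr_mono2'[of "- \<theta>" "1 - x" 1] assms theta_range by simp
  moreover have "\<theta> / (1 + \<theta>) = 1 - 1 / (1 + \<theta>)" using theta_range by (simp add: field_simps)
  ultimately show ?thesis by simp
qed

lemma survival_formula:
  assumes "0 \<le> t" "0 \<le> x" "x < 1"
  shows "1 - pgf (kernel 0 t) x = growth t * ((1 - x) powr (- \<theta>) - 1 / (1 + \<theta>) + V_scaled t) powr (- 1 / \<theta>)"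
proof -
  define Y where "Y = (1 - x) powr (- \<theta>) - 1 / (1 + \<theta>) + V_scaled t"
  have th: "0 < \<theta>" using theta_range by simp
  have "0 < \<theta> / (1 + \<theta>)" using th by simp
  with powr_minus_kappa[OF assms(2,3)] V_scaled_pos[OF assms(1)] have Y: "0 < Y"
    unfolding Y_def by linarith
  have pos: "0 < 1 - pgf (kernel 0 t) x"
  proof -
    have "0 < exp (- (Lam t - Lam 0)) * (1 - x)" using assms by simp
    with kernel_pgf_gap[of 0 t x] assms show ?thesis by linarith
  qed
  have "growth t powr (- \<theta>) * growth t powr \<theta> = 1"
    unfolding powr_add[symmetric] using growth_pos[of t] by (simp del: growth_pos)
  hence "(1 - pgf (kernel 0 t) x) powr (- \<theta>) = growth t powr (- \<theta>) * Y"
    unfolding explicit_pgf_formula[OF assms] Y_def V_scaled_def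
    by (simp add: distrib_left mult.assoc[symmetric])
  hence "((1 - pgf (kernel 0 t) x) powr (- \<theta>)) powr (- 1 / \<theta>) = (growth t powr (- \<theta>)) powr (- 1 / \<theta>) * Y powr (- 1 / \<theta>)"
    by (simp add: powr_mult)
  thus ?thesis
    using th pos growth_pos[of t] unfolding powr_powr Y_def[symmetric] by (simp del: growth_pos)
qed

lemma distr_Z:
  assumes "0 \<le> t"
  shows "distr M (count_space UNIV) (Z t) = measure_pmf (kernel 0 t)"
proof (rule measure_eqI_countable[where A=UNIV])
  fix j :: nat
  have "Z t -` {j} \<inter> space M = {\<omega> \<in> space M. Z t \<omega> = j}" by auto
  thus "emeasure (distr M (count_space UNIV) (Z t)) {j} = emeasure (measure_pmf (kernel 0 t)) {j}"
    using Z_measurable[OF assms] Z_law[OF assms]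
    by (simp add: emeasure_distr emeasure_pmf_single emeasure_eq_measure)
qed auto

lemma expectation_Z:
  fixes f :: "nat \<Rightarrow> real"
  assumes "0 \<le> t"
  shows "(LINT \<omega>|M. f (Z t \<omega>)) = measure_pmf.expectation (kernel 0 t) f"
  unfolding distr_Z[OF assms, symmetric] using Z_measurable[OF assms]
  by (intro integral_distr[symmetric]) auto

text \<open>
  The difference quotients of the generating function at \<open>1\<close> are the expectations of the geometric
  sums \<open>f n k\<close>, which increase to \<open>k\<close>; monotone convergence identifies the mean with their limit.
\<close>

lemma mean_size_eq:
  assumes t: "0 \<le> t"
  shows "mean_size M Z t = growth t"
proof -
  have th: "0 < \<theta>" using theta_range by simp
  define y where "y n = 1 / real (Suc n)" for n
  define f where "f n k = (\<Sum>j<k. (1 - y n) ^ j)" for n k :: nat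
  have y: "0 < y n" "y n \<le> 1" for n by (auto simp: y_def)
  have y0: "y \<longlonglongrightarrow> 0" unfolding y_def by (rule LIMSEQ_Suc[OF lim_1_over_n])
  have f_eq: "f n k = (1 - (1 - y n) ^ k) / y n" for n k
    using one_diff_power_eq[of "1 - y n" k] y[of n] by (simp add: f_def)
  have int: "integrable (measure_pmf (kernel 0 t)) (f n)" for n
    unfolding f_eq using y[of n]
    by (intro integrable_divide Bochner_Integration.integrable_diff integrable_power_pmf) auto
  have "mean_size M Z t = measure_pmf.expectation (kernel 0 t) real"
    unfolding mean_size_def by (rule expectation_Z[OF t])
  also have "\<dots> = growth t"
  proof (rule integral_monotone_convergence[where f=f])
    show "AE k in kernel 0 t. mono (\<lambda>n. f n k)"
    proof (intro AE_I2 monoI)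
      fix k m n :: nat assume "m \<le> n"
      hence "y n \<le> y m" by (simp add: y_def frac_le)
      thus "f m k \<le> f n k"
        unfolding f_def using y[of m] by (intro sum_mono power_mono) auto
    qed
    show "AE k in kernel 0 t. (\<lambda>n. f n k) \<longlonglongrightarrow> real k"
    proof (intro AE_I2)
      fix k
      have "(\<lambda>n. f n k) \<longlonglongrightarrow> (\<Sum>j<k. (1 - 0) ^ j)"
        unfolding f_def by (intro tendsto_intros y0)
      thus "(\<lambda>n. f n k) \<longlonglongrightarrow> real k" by simp
    qed
    have "measure_pmf.expectation (kernel 0 t) (f n) =
      growth t * (1 - y n powr \<theta> / (1 + \<theta>) + y n powr \<theta> * V_scaled t) powr (- 1 / \<theta>)" if "n > 0" for n
    proof -
      have yn: "y n < 1" using that by (simp add: y_def)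
      let ?Y = "y n powr (- \<theta>) - 1 / (1 + \<theta>) + V_scaled t"
      have "measure_pmf.expectation (kernel 0 t) (f n) = (1 - pgf (kernel 0 t) (1 - y n)) / y n"
        unfolding f_eq pgf_def using y[of n] integrable_power_pmf[of "1 - y n" "kernel 0 t"] by simp
      also have "\<dots> = growth t * (?Y powr (- 1 / \<theta>) / y n)"
        using survival_formula[OF t, of "1 - y n"] y[of n] yn by simp
      also have "?Y powr (- 1 / \<theta>) / y n = (?Y / y n powr - \<theta>) powr (- 1 / \<theta>)"
      proof -
        have "(y n powr - \<theta>) powr (- 1 / \<theta>) = y n"
          unfolding powr_powr using th y[of n] by simp
        thus ?thesis by (simp add: powr_divide)
      qed
      also have "?Y / y n powr - \<theta> = 1 - y n powr \<theta> / (1 + \<theta>) + y n powr \<theta> * V_scaled t"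
      proof -
        have "(1 / Y - c + S) / (1 / Y) = 1 - Y * c + Y * S" if "0 < Y" for Y c S :: real
          using that by (simp add: field_simps)
        from this[of "y n powr \<theta>" "1 / (1 + \<theta>)" "V_scaled t"] show ?thesis
          using y[of n] by (simp add: powr_minus_divide)
      qed
      finally show ?thesis by simp
    qed
    hence ev: "eventually (\<lambda>n::nat. growth t * (1 - y n powr \<theta> / (1 + \<theta>) + y n powr \<theta> * V_scaled t) powr (- 1 / \<theta>)
       = measure_pmf.expectation (kernel 0 t) (f n)) sequentially"
      by (intro eventually_mono[OF eventually_gt_at_top[of 0]]) auto
    have "(\<lambda>n. y n powr \<theta>) \<longlonglongrightarrow> 0"
      using y y0 th by (intro tendsto_zero_powrI) (auto intro!: tendsto_const simp: less_imp_le)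
    hence "(\<lambda>n. growth t * (1 - y n powr \<theta> / (1 + \<theta>) + y n powr \<theta> * V_scaled t) powr (- 1 / \<theta>)) \<longlonglongrightarrow>
        growth t * (1 - 0 / (1 + \<theta>) + 0 * V_scaled t) powr (- 1 / \<theta>)"
      using th by (intro tendsto_intros) auto
    hence "(\<lambda>n. growth t * (1 - y n powr \<theta> / (1 + \<theta>) + y n powr \<theta> * V_scaled t) powr (- 1 / \<theta>)) \<longlonglongrightarrow> growth t"
      by simp
    thus "(\<lambda>n. measure_pmf.expectation (kernel 0 t) (f n)) \<longlonglongrightarrow> growth t"
      using ev by (rule Lim_transform_eventually)
  qed (use int in auto)
  finally show ?thesis .
qed

lemma V_theta_eq:
  assumes "0 \<le> t"
  shows "V_theta M Z \<theta> lam t = Vint t"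
  unfolding V_theta_def Vint_def
  by (intro arg_cong2[of _ _ _ _ "(*)"] refl set_lebesgue_integral_cong) (auto simp: mean_size_eq)

lemma pgf_kernel_0:
  assumes "0 \<le> t"
  shows "pgf (kernel 0 t) 0 = measure M {\<omega> \<in> space M. Z t \<omega> = 0}"
  using pgf_sums[of 0 "kernel 0 t"] by (simp add: Z_law[OF assms] sums_unique2)

lemma survival_prob_pgf:
  assumes "0 \<le> t"
  shows "survival_prob M Z t = 1 - pgf (kernel 0 t) 0"
proof -
  have "{\<omega> \<in> space M. Z t \<omega> > 0} = space M - {\<omega> \<in> space M. Z t \<omega> = 0}" by auto
  thus ?thesis
    unfolding survival_prob_def pgf_kernel_0[OF assms] using Z_event[OF assms, of "\<lambda>n. n = 0"]
    by (simp add: prob_compl)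
qed

lemma survival_prob_eq:
  assumes "0 \<le> t"
  shows "survival_prob M Z t = growth t * (\<theta> / (1 + \<theta>) + V_scaled t) powr (- 1 / \<theta>)"
proof -
  have "1 - 1 / (1 + \<theta>) = \<theta> / (1 + \<theta>)" using theta_range by (simp add: field_simps)
  thus ?thesis using survival_formula[OF assms, of 0] by (simp add: survival_prob_pgf[OF assms])
qed

lemma survival_prob_pos:
  assumes "0 \<le> t"
  shows "0 < survival_prob M Z t"
proof -
  have "0 \<le> \<theta> / (1 + \<theta>)" using theta_range by simp
  with V_scaled_pos[OF assms] have "\<theta> / (1 + \<theta>) + V_scaled t \<noteq> 0" by linarith
  thus ?thesis by (simp add: survival_prob_eq[OF assms])
qed

lemma cond_mean_size_eq:
  assumes "0 \<le> t"
  shows "cond_mean_size M Z t = (\<theta> / (1 + \<theta>) + V_scaled t) powr (1 / \<theta>)"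
    and "cond_mean_size M Z t * survival_prob M Z t = mean_size M Z t"
proof -
  have "(LINT \<omega>:{\<omega> \<in> space M. Z t \<omega> > 0}|M. real (Z t \<omega>)) = mean_size M Z t"
    unfolding mean_size_def set_lebesgue_integral_def
    by (intro Bochner_Integration.integral_cong) (auto split: split_indicator)
  hence eq: "cond_mean_size M Z t = mean_size M Z t / survival_prob M Z t"
    by (simp add: cond_mean_size_def cond_exp_survival_def)
  show "cond_mean_size M Z t * survival_prob M Z t = mean_size M Z t"
    using survival_prob_pos[OF assms] by (simp add: eq)
  have "- 1 / \<theta> = - (1 / \<theta>)" by simp
  thus "cond_mean_size M Z t = (\<theta> / (1 + \<theta>) + V_scaled t) powr (1 / \<theta>)"
    using growth_pos[of t] unfolding eq mean_size_eq[OF assms] survival_prob_eq[OF assms]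
    by (simp add: powr_minus divide_simps del: growth_pos)
qed

lemma cond_mean_size_ge_1:
  assumes "0 \<le> t"
  shows "1 \<le> cond_mean_size M Z t"
proof -
  have "integrable (measure_pmf (kernel 0 t)) real"
  proof (rule ccontr)
    assume "\<not> integrable (measure_pmf (kernel 0 t)) real"
    hence "measure_pmf.expectation (kernel 0 t) real = 0"
      by (rule not_integrable_integral_eq)
    moreover have "measure_pmf.expectation (kernel 0 t) real = growth t"
      using mean_size_eq[OF assms] expectation_Z[OF assms, of real] by (simp add: mean_size_def)
    ultimately show False using growth_pos[of t] by simp
  qed
  hence "measure_pmf.expectation (kernel 0 t) (\<lambda>k. 1 - 0 ^ k) \<le> measure_pmf.expectation (kernel 0 t) real"
    using integrable_power_pmf[of 0 "kernel 0 t"]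
    by (intro integral_mono) (auto simp: power_0_left)
  also have "measure_pmf.expectation (kernel 0 t) (\<lambda>k. 1 - 0 ^ k) = survival_prob M Z t"
    using integrable_power_pmf[of 0 "kernel 0 t"]
    by (simp add: survival_prob_pgf[OF assms] pgf_def)
  also have "measure_pmf.expectation (kernel 0 t) real = mean_size M Z t"
    unfolding mean_size_def by (rule expectation_Z[OF assms, symmetric])
  finally have "survival_prob M Z t \<le> cond_mean_size M Z t * survival_prob M Z t"
    by (simp add: cond_mean_size_eq(2)[OF assms])
  thus ?thesis using survival_prob_pos[OF assms] by simp
qed

lemma cond_pgf_eq:
  assumes t: "0 \<le> t" and s: "0 \<le> s" "s \<le> 1"
  shows "cond_exp_survival M Z t (\<lambda>k. s ^ k) = 1 - (1 - pgf (kernel 0 t) s) / survival_prob M Z t"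
proof -
  \<comment> \<open>\<open>0 ^ n\<close> is the indicator of \<open>n = 0\<close>\<close>
  have "(LINT \<omega>:{\<omega> \<in> space M. Z t \<omega> > 0}|M. s ^ Z t \<omega>) = (LINT \<omega>|M. s ^ Z t \<omega> - 0 ^ Z t \<omega>)"
    unfolding set_lebesgue_integral_def
    by (intro Bochner_Integration.integral_cong) (auto split: split_indicator simp: power_0_left)
  also have "\<dots> = pgf (kernel 0 t) s - pgf (kernel 0 t) 0"
    unfolding pgf_def expectation_Z[OF t, of "\<lambda>k. s ^ k - 0 ^ k"]
    using s by (intro Bochner_Integration.integral_diff integrable_power_pmf) auto
  also have "\<dots> = survival_prob M Z t - (1 - pgf (kernel 0 t) s)"
    by (simp add: survival_prob_pgf[OF t])
  finally show ?thesis
    using survival_prob_pos[OF t] by (simp add: cond_exp_survival_def diff_divide_distrib)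
qed

end

section \<open>Limits\<close>

context theta_positive_bpve
begin

text \<open>
  Trivially \<open>E (Z | Z > 0) \<ge> 1\<close>. Inserting the explicit conditional mean turns this into a lower bound
  for \<open>Vint\<close>: if \<open>growth\<close> tends to \<open>0\<close>, then \<open>Vint\<close> must diverge.
\<close>

lemma growth_powr_le_V:
  assumes "0 \<le> t"
  shows "growth t powr (- \<theta>) \<le> 1 + (1 + \<theta>) * Vint t"
proof -
  have th: "0 < \<theta>" using theta_range by simp
  have "1 \<le> \<theta> / (1 + \<theta>) + V_scaled t"
  proof (rule ccontr)
    assume "\<not> 1 \<le> \<theta> / (1 + \<theta>) + V_scaled t"
    moreover have "0 \<le> \<theta> / (1 + \<theta>)" using th by simp
    ultimately have "(\<theta> / (1 + \<theta>) + V_scaled t) powr (1 / \<theta>) < 1"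
      using powr_less_mono2[of "1 / \<theta>" "\<theta> / (1 + \<theta>) + V_scaled t" 1] th V_scaled_pos[OF assms] by simp
    thus False using cond_mean_size_ge_1[OF assms] cond_mean_size_eq(1)[OF assms] by simp
  qed
  hence "1 / (1 + \<theta>) \<le> V_scaled t" using th by (simp add: field_simps)
  hence "1 \<le> (1 + \<theta>) * V_scaled t" using th by (simp add: field_simps)
  also have "(1 + \<theta>) * V_scaled t = growth t powr \<theta> * (1 + (1 + \<theta>) * Vint t)"
    using th by (simp add: V_scaled_def field_simps)
  finally have "growth t powr (- \<theta>) * 1 \<le> growth t powr (- \<theta>) * (growth t powr \<theta> * (1 + (1 + \<theta>) * Vint t))"
    by (intro mult_left_mono) auto
  moreover have "growth t powr (- \<theta>) * growth t powr \<theta> = 1"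
    unfolding powr_add[symmetric] using growth_pos[of t] by (simp del: growth_pos)
  ultimately show ?thesis by (simp add: mult.assoc[symmetric])
qed

text \<open>
  If \<open>\<mu>\<^sub>t\<^sup>\<theta> V\<^sub>t\<close> stays bounded while \<open>V\<^sub>t\<close> diverges, the other factor has to vanish.
\<close>

lemma growth_vanishes:
  assumes V: "filterlim Vint at_top at_top" and lim: "((\<lambda>t. growth t powr \<theta> * Vint t) \<longlongrightarrow> m0) at_top"
  shows "(growth \<longlongrightarrow> 0) at_top"
proof -
  have th: "0 < \<theta>" using theta_range by simp
  have "((\<lambda>t. (growth t powr \<theta> * Vint t) / Vint t) \<longlongrightarrow> 0) at_top"
    by (rule real_tendsto_divide_at_top[OF lim V])
  moreover have "eventually (\<lambda>t. (growth t powr \<theta> * Vint t) / Vint t = growth t powr \<theta>) at_top"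
    using filterlim_at_top_dense[THEN iffD1, OF V, rule_format, of 0] by eventually_elim auto
  ultimately have "((\<lambda>t. growth t powr \<theta>) \<longlongrightarrow> 0) at_top"
    by (rule Lim_transform_eventually)
  hence "((\<lambda>t. (growth t powr \<theta>) powr (1 / \<theta>)) \<longlongrightarrow> 0) at_top"
    by (rule tendsto_zero_powrI[OF _ tendsto_const]) (use th in auto)
  thus ?thesis
    unfolding powr_powr using th by (simp add: abs_of_pos)
qed

lemma V_scaled_tendsto:
  assumes "(growth \<longlongrightarrow> 0) at_top" and lim: "((\<lambda>t. growth t powr \<theta> * Vint t) \<longlongrightarrow> m0) at_top"
  shows "(V_scaled \<longlongrightarrow> m0) at_top"
proof -
  have th: "0 < \<theta>" using theta_range by simp
  have "((\<lambda>t. growth t powr \<theta>) \<longlongrightarrow> 0) at_top"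
    using assms(1) th by (intro tendsto_zero_powrI[OF _ tendsto_const]) (auto simp: less_imp_le)
  hence "((\<lambda>t. growth t powr \<theta> * Vint t + growth t powr \<theta> / (1 + \<theta>)) \<longlongrightarrow> m0 + 0 / (1 + \<theta>)) at_top"
    using th by (intro tendsto_intros lim) auto
  thus ?thesis by (simp add: V_scaled_def[abs_def])
qed

lemma cond_mean_size_tendsto:
  assumes "(V_scaled \<longlongrightarrow> m0) at_top" "0 \<le> m0"
  shows "(cond_mean_size M Z \<longlongrightarrow> (m0 + \<theta> / (1 + \<theta>)) powr (1 / \<theta>)) at_top"
proof -
  have "0 < \<theta> / (1 + \<theta>)" using theta_range by simp
  hence "((\<lambda>t. (\<theta> / (1 + \<theta>) + V_scaled t) powr (1 / \<theta>)) \<longlongrightarrow> (\<theta> / (1 + \<theta>) + m0) powr (1 / \<theta>)) at_top"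
    using assms by (intro tendsto_intros) auto
  moreover have "eventually (\<lambda>t. (\<theta> / (1 + \<theta>) + V_scaled t) powr (1 / \<theta>) = cond_mean_size M Z t) at_top"
    using eventually_ge_at_top[of 0] by eventually_elim (simp add: cond_mean_size_eq(1))
  ultimately show ?thesis
    by (subst add.commute) (rule Lim_transform_eventually)
qed

lemma limit_V_nonneg:
  assumes "((\<lambda>t. growth t powr \<theta> * Vint t) \<longlongrightarrow> m0) at_top"
  shows "0 \<le> m0"
proof (rule tendsto_lowerbound[OF assms])
  show "eventually (\<lambda>t. 0 \<le> growth t powr \<theta> * Vint t) at_top"
    using eventually_ge_at_top[of 0] by eventually_elim (simp add: Vint_nonneg)
qed simp

text \<open>
  The survival probability is at most the mean, so extinction follows from \<open>growth_vanishes\<close>.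
\<close>

lemma strictly_subcriticalI:
  assumes V: "filterlim Vint at_top at_top" and lim: "((\<lambda>t. growth t powr \<theta> * Vint t) \<longlongrightarrow> m0) at_top"
  shows "strictly_subcritical M Z"
  unfolding strictly_subcritical_def
proof
  note growth0 = growth_vanishes[OF V lim]
  have m0: "0 \<le> m0" by (rule limit_V_nonneg[OF lim])
  let ?m = "(m0 + \<theta> / (1 + \<theta>)) powr (1 / \<theta>)"
  have mean: "(cond_mean_size M Z \<longlongrightarrow> ?m) at_top"
    by (rule cond_mean_size_tendsto[OF V_scaled_tendsto[OF growth0 lim] m0])
  moreover have ge1: "eventually (\<lambda>t. 1 \<le> cond_mean_size M Z t) at_top"
    using eventually_ge_at_top[of 0] by eventually_elim (rule cond_mean_size_ge_1)
  ultimately have "1 \<le> ?m"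
    by (rule tendsto_lowerbound) simp
  with mean show "\<exists>m\<ge>1. (cond_mean_size M Z \<longlongrightarrow> m) at_top" by blast
  have "(survival_prob M Z \<longlongrightarrow> 0) at_top"
  proof (rule tendsto_sandwich[OF _ _ tendsto_const growth0])
    show "eventually (\<lambda>t. 0 \<le> survival_prob M Z t) at_top"
      by (simp add: survival_prob_def)
    show "eventually (\<lambda>t. survival_prob M Z t \<le> growth t) at_top"
      using eventually_ge_at_top[of 0] ge1
    proof eventually_elim
      case (elim t)
      have "1 * survival_prob M Z t \<le> cond_mean_size M Z t * survival_prob M Z t"
        using elim survival_prob_pos[of t] by (intro mult_right_mono) auto
      thus ?case using elim by (simp add: cond_mean_size_eq(2) mean_size_eq)
    qed
  qed
  hence "((\<lambda>t. 1 - survival_prob M Z t) \<longlongrightarrow> 1 - 0) at_top"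
    by (intro tendsto_intros)
  moreover have "eventually (\<lambda>t. 1 - survival_prob M Z t = measure M {\<omega> \<in> space M. Z t \<omega> = 0}) at_top"
    using eventually_ge_at_top[of 0]
    by eventually_elim (simp add: survival_prob_pgf pgf_kernel_0)
  ultimately show "((\<lambda>t. measure M {\<omega> \<in> space M. Z t \<omega> = 0}) \<longlongrightarrow> 1) at_top"
    by (simp add: Lim_transform_eventually)
qed

text \<open>
  The mean is the product of the conditional mean, which converges, and the survival probability,
  which vanishes. Once \<open>growth\<close> is known to vanish, \<open>growth_powr_le_V\<close> forces \<open>Vint\<close> to diverge, and
  the limit of \<open>\<mu>\<^sub>t\<^sup>\<theta> V\<^sub>t\<close> is read off from that of the conditional mean.
\<close>

lemma strictly_subcriticalD:
  assumes sub: "strictly_subcritical M Z"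
  shows "(growth \<longlongrightarrow> 0) at_top" and "filterlim Vint at_top at_top"
    and "\<exists>m0\<ge>0. ((\<lambda>t. growth t powr \<theta> * Vint t) \<longlongrightarrow> m0) at_top"
proof -
  have th: "0 < \<theta>" using theta_range by simp
  from sub obtain m where q: "((\<lambda>t. measure M {\<omega> \<in> space M. Z t \<omega> = 0}) \<longlongrightarrow> 1) at_top"
    and m: "1 \<le> m" "(cond_mean_size M Z \<longlongrightarrow> m) at_top"
    unfolding strictly_subcritical_def by auto
  have "((\<lambda>t. cond_mean_size M Z t * (1 - measure M {\<omega> \<in> space M. Z t \<omega> = 0})) \<longlongrightarrow> m * (1 - 1)) at_top"
    by (intro tendsto_intros m q)
  moreover have "eventually (\<lambda>t. cond_mean_size M Z t * (1 - measure M {\<omega> \<in> space M. Z t \<omega> = 0}) = growth t) at_top"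
    using eventually_ge_at_top[of 0]
    by eventually_elim
      (simp add: cond_mean_size_eq(2) flip: pgf_kernel_0 survival_prob_pgf mean_size_eq)
  ultimately show growth0: "(growth \<longlongrightarrow> 0) at_top"
    by (simp add: Lim_transform_eventually)
  have growth_powr0: "((\<lambda>t. growth t powr \<theta>) \<longlongrightarrow> 0) at_top"
    using growth0 th by (intro tendsto_zero_powrI[OF _ tendsto_const]) (auto simp: less_imp_le)
  have "filterlim (\<lambda>t. inverse (growth t powr \<theta>)) at_top at_top"
    using growth_pos by (intro filterlim_inverse_at_top growth_powr0) (auto simp: less_imp_neq[symmetric])
  hence "filterlim (\<lambda>t. growth t powr (- \<theta>)) at_top at_top"
    by (simp add: powr_minus)
  hence "filterlim (\<lambda>t. 1 + (1 + \<theta>) * Vint t) at_top at_top"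
  proof (rule filterlim_at_top_mono)
    show "eventually (\<lambda>t. growth t powr (- \<theta>) \<le> 1 + (1 + \<theta>) * Vint t) at_top"
      using eventually_ge_at_top[of 0] by eventually_elim (rule growth_powr_le_V)
  qed
  hence "filterlim (\<lambda>t. - 1 + (1 + (1 + \<theta>) * Vint t)) at_top at_top"
    by (rule filterlim_tendsto_add_at_top[OF tendsto_const])
  hence "filterlim (\<lambda>t. inverse (1 + \<theta>) * (- 1 + (1 + (1 + \<theta>) * Vint t))) at_top at_top"
    using th by (intro filterlim_tendsto_pos_mult_at_top[OF tendsto_const]) auto
  moreover have "inverse (1 + \<theta>) * (- 1 + (1 + (1 + \<theta>) * v)) = v" for v
  proof -
    have "1 + \<theta> \<noteq> 0" using th by linarith
    thus ?thesis by (simp add: mult.assoc[symmetric])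
  qed
  ultimately show "filterlim Vint at_top at_top"
    by (simp only:)
  have "((\<lambda>t. cond_mean_size M Z t powr \<theta> - \<theta> / (1 + \<theta>) - growth t powr \<theta> / (1 + \<theta>)) \<longlongrightarrow>
     m powr \<theta> - \<theta> / (1 + \<theta>) - 0 / (1 + \<theta>)) at_top"
    using m th by (intro tendsto_intros growth_powr0) auto
  moreover have "eventually (\<lambda>t. cond_mean_size M Z t powr \<theta> - \<theta> / (1 + \<theta>) - growth t powr \<theta> / (1 + \<theta>) =
      growth t powr \<theta> * Vint t) at_top"
    using eventually_ge_at_top[of 0]
  proof eventually_elim
    case (elim t)
    have "0 \<le> \<theta> / (1 + \<theta>)" using th by simp
    hence "cond_mean_size M Z t powr \<theta> = \<theta> / (1 + \<theta>) + V_scaled t"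
      using V_scaled_pos[of t] th elim by (simp add: cond_mean_size_eq(1) powr_powr)
    thus ?case by (simp add: V_scaled_def)
  qed
  ultimately have "((\<lambda>t. growth t powr \<theta> * Vint t) \<longlongrightarrow> m powr \<theta> - \<theta> / (1 + \<theta>) - 0 / (1 + \<theta>)) at_top"
    by (rule Lim_transform_eventually)
  with limit_V_nonneg[OF this] show "\<exists>m0\<ge>0. ((\<lambda>t. growth t powr \<theta> * Vint t) \<longlongrightarrow> m0) at_top"
    by blast
qed

text \<open>
  The survival probability and \<open>1 - pgf\<close> at \<open>s\<close> carry the same factor \<open>growth\<close>, so it cancels in the
  conditional generating function.
\<close>

lemma subcritical_limits:
  assumes growth0: "(growth \<longlongrightarrow> 0) at_top" and lim: "((\<lambda>t. growth t powr \<theta> * Vint t) \<longlongrightarrow> m0) at_top"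
  defines "m \<equiv> (m0 + \<theta> / (1 + \<theta>)) powr (1 / \<theta>)"
  shows "(mean_size M Z \<longlongrightarrow> 0) at_top"
    and "((\<lambda>t. survival_prob M Z t / (inverse m * mean_size M Z t)) \<longlongrightarrow> 1) at_top"
    and "(cond_mean_size M Z \<longlongrightarrow> m) at_top"
    and "\<And>s. 0 \<le> s \<Longrightarrow> s < 1 \<Longrightarrow> ((\<lambda>t. cond_exp_survival M Z t (\<lambda>k. s ^ k)) \<longlongrightarrow>
      1 - m * (m0 - 1 / (1 + \<theta>) + (1 - s) powr (- \<theta>)) powr (- 1 / \<theta>)) at_top"
    and "((\<lambda>t. cond_exp_survival M Z t (\<lambda>k. 1 ^ k)) \<longlongrightarrow> 1) at_top"
proof -
  have th: "0 < \<theta>" "0 < \<theta> / (1 + \<theta>)" using theta_range by simp_all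
  have m0: "0 \<le> m0" by (rule limit_V_nonneg[OF lim])
  have "0 < m0 + \<theta> / (1 + \<theta>)" using m0 th by linarith
  hence m: "0 < m" by (simp add: m_def)
  note scaled = V_scaled_tendsto[OF growth0 lim]
  show "(mean_size M Z \<longlongrightarrow> 0) at_top"
  proof (rule Lim_transform_eventually[OF growth0])
    show "eventually (\<lambda>t. growth t = mean_size M Z t) at_top"
      using eventually_ge_at_top[of 0] by eventually_elim (simp add: mean_size_eq)
  qed
  show mean: "(cond_mean_size M Z \<longlongrightarrow> m) at_top"
    unfolding m_def by (rule cond_mean_size_tendsto[OF scaled m0])
  have "((\<lambda>t. m / cond_mean_size M Z t) \<longlongrightarrow> m / m) at_top"
    using m by (intro tendsto_intros mean) auto
  hence "((\<lambda>t. m / cond_mean_size M Z t) \<longlongrightarrow> 1) at_top"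
    using m by simp
  thus "((\<lambda>t. survival_prob M Z t / (inverse m * mean_size M Z t)) \<longlongrightarrow> 1) at_top"
  proof (rule Lim_transform_eventually)
    show "eventually (\<lambda>t. m / cond_mean_size M Z t = survival_prob M Z t / (inverse m * mean_size M Z t)) at_top"
      using eventually_ge_at_top[of 0]
    proof eventually_elim
      case (elim t)
      show ?case
        using m survival_prob_pos[OF elim] cond_mean_size_ge_1[OF elim]
        unfolding cond_mean_size_eq(2)[OF elim, symmetric] by (simp add: field_simps)
    qed
  qed
  show "((\<lambda>t. cond_exp_survival M Z t (\<lambda>k. s ^ k)) \<longlongrightarrow>
      1 - m * (m0 - 1 / (1 + \<theta>) + (1 - s) powr (- \<theta>)) powr (- 1 / \<theta>)) at_top"
    if s: "0 \<le> s" "s < 1" for s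
  proof -
    let ?k = "(1 - s) powr (- \<theta>) - 1 / (1 + \<theta>)"
    have k: "0 < ?k" using powr_minus_kappa[OF s] th by linarith
    have "((\<lambda>t. 1 - cond_mean_size M Z t * (?k + V_scaled t) powr (- 1 / \<theta>)) \<longlongrightarrow>
       1 - m * (?k + m0) powr (- 1 / \<theta>)) at_top"
      using k m0 th by (intro tendsto_intros mean scaled) auto
    moreover have "eventually (\<lambda>t. 1 - cond_mean_size M Z t * (?k + V_scaled t) powr (- 1 / \<theta>) =
        cond_exp_survival M Z t (\<lambda>k. s ^ k)) at_top"
      using eventually_ge_at_top[of 0]
    proof eventually_elim
      case (elim t)
      have "growth t = cond_mean_size M Z t * survival_prob M Z t"
        using elim by (simp add: cond_mean_size_eq(2) mean_size_eq)
      hence "1 - pgf (kernel 0 t) s = cond_mean_size M Z t * (?k + V_scaled t) powr (- 1 / \<theta>) * survival_prob M Z t"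
        using survival_formula[OF elim s] by simp
      thus ?case
        using cond_pgf_eq[OF elim, of s] s survival_prob_pos[OF elim] by simp
    qed
    ultimately have "((\<lambda>t. cond_exp_survival M Z t (\<lambda>k. s ^ k)) \<longlongrightarrow> 1 - m * (?k + m0) powr (- 1 / \<theta>)) at_top"
      by (rule Lim_transform_eventually)
    thus ?thesis by (simp add: algebra_simps)
  qed
  have "eventually (\<lambda>t. cond_exp_survival M Z t (\<lambda>k. 1 ^ k) = 1) at_top"
    using eventually_ge_at_top[of 0] by eventually_elim (use cond_pgf_eq[of _ 1] in simp)
  thus "((\<lambda>t. cond_exp_survival M Z t (\<lambda>k. 1 ^ k)) \<longlongrightarrow> 1) at_top"
    by (rule tendsto_eventually)
qed

lemma V_theta_limits:
  shows "filterlim (V_theta M Z \<theta> lam) at_top at_top \<longleftrightarrow> filterlim Vint at_top at_top"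
    and "((\<lambda>t. mean_size M Z t powr \<theta> * V_theta M Z \<theta> lam t) \<longlongrightarrow> m0) at_top \<longleftrightarrow>
      ((\<lambda>t. growth t powr \<theta> * Vint t) \<longlongrightarrow> m0) at_top"
proof -
  have ev: "eventually (\<lambda>t. V_theta M Z \<theta> lam t = Vint t \<and> mean_size M Z t = growth t) at_top"
    using eventually_ge_at_top[of 0] by eventually_elim (simp add: mean_size_eq V_theta_eq)
  show "filterlim (V_theta M Z \<theta> lam) at_top at_top \<longleftrightarrow> filterlim Vint at_top at_top"
    by (rule filterlim_cong[OF refl refl]) (use ev in \<open>auto elim: eventually_mono\<close>)
  show "((\<lambda>t. mean_size M Z t powr \<theta> * V_theta M Z \<theta> lam t) \<longlongrightarrow> m0) at_top \<longleftrightarrow>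
      ((\<lambda>t. growth t powr \<theta> * Vint t) \<longlongrightarrow> m0) at_top"
    by (rule filterlim_cong[OF refl refl]) (use ev in \<open>auto elim: eventually_mono\<close>)
qed

end

theorem theorem2p7:
  fixes M :: "'w measure" and Z :: "real \<Rightarrow> 'w \<Rightarrow> nat"
    and \<theta> :: real and lam a :: "real \<Rightarrow> real" and p :: "real \<Rightarrow> nat pmf"
  assumes "theta_positive_bpve M Z \<theta> lam a p"
  shows
    "(strictly_subcritical M Z \<longleftrightarrow>
        filterlim (V_theta M Z \<theta> lam) at_top at_top \<and>
        (\<exists>M\<theta>\<ge>0. ((\<lambda>t. mean_size M Z t powr \<theta> * V_theta M Z \<theta> lam t) \<longlongrightarrow> M\<theta>) at_top)) \<and>
     (\<forall>M\<theta> m.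
        strictly_subcritical M Z \<longrightarrow>
        ((\<lambda>t. mean_size M Z t powr \<theta> * V_theta M Z \<theta> lam t) \<longlongrightarrow> M\<theta>) at_top \<longrightarrow>
        m = (M\<theta> + \<theta> / (1 + \<theta>)) powr (1 / \<theta>) \<longrightarrow>
        (mean_size M Z \<longlongrightarrow> 0) at_top \<and>
        ((\<lambda>t. survival_prob M Z t / (inverse m * mean_size M Z t)) \<longlongrightarrow> 1) at_top \<and>
        (cond_mean_size M Z \<longlongrightarrow> m) at_top \<and>
        (\<forall>s. 0 \<le> s \<and> s \<le> 1 \<longrightarrow>
          ((\<lambda>t. cond_exp_survival M Z t (\<lambda>k. s ^ k)) \<longlongrightarrow>
            (if s = 1 then 1
             else 1 - m * (M\<theta> - 1 / (1 + \<theta>) + (1 - s) powr (- \<theta>)) powr (- 1 / \<theta>))) at_top))"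
proof -
  interpret theta_positive_bpve M Z \<theta> lam a p by fact
  show ?thesis
    unfolding V_theta_limits
  proof (intro conjI allI impI)
    show "strictly_subcritical M Z \<longleftrightarrow> filterlim Vint at_top at_top \<and>
        (\<exists>M\<theta>\<ge>0. ((\<lambda>t. growth t powr \<theta> * Vint t) \<longlongrightarrow> M\<theta>) at_top)"
      using strictly_subcriticalI strictly_subcriticalD(2,3) by blast
  next
    fix M\<theta> m s :: real
    assume sub: "strictly_subcritical M Z" and lim: "((\<lambda>t. growth t powr \<theta> * Vint t) \<longlongrightarrow> M\<theta>) at_top"
      and m: "m = (M\<theta> + \<theta> / (1 + \<theta>)) powr (1 / \<theta>)"
    note limits = subcritical_limits[OF strictly_subcriticalD(1)[OF sub] lim, folded m]
    show "(mean_size M Z \<longlongrightarrow> 0) at_top"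
      "((\<lambda>t. survival_prob M Z t / (inverse m * mean_size M Z t)) \<longlongrightarrow> 1) at_top"
      "(cond_mean_size M Z \<longlongrightarrow> m) at_top"
      by (rule limits)+
    assume s: "0 \<le> s \<and> s \<le> 1"
    show "((\<lambda>t. cond_exp_survival M Z t (\<lambda>k. s ^ k)) \<longlongrightarrow>
            (if s = 1 then 1
             else 1 - m * (M\<theta> - 1 / (1 + \<theta>) + (1 - s) powr (- \<theta>)) powr (- 1 / \<theta>))) at_top"
      using limits(4)[of s] limits(5) s by (cases "s = 1") auto
  qed
qed

end
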